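(* Let $p$ be a prime, let $n,d$ be positive integers, let $\delta\in(0,1]$ be a distance parameter, and let $t$ be an erasure parameter with $t \leq \frac{\delta}{30}p^{n/(20d)}$. Then there is a $t$-online-erasure-resilient tester for degree $d$ for functions $f:\mathbb{F}_p^n\to\mathbb{F}_p$ with query complexity $O\!\left(\frac{\log^{3d+3}(t/\delta)}{\delta}\right)$, satisfying: (Completeness) if $f$ has degree at most $d$, the tester accepts with probability $1$; (Soundness) if $f$ is $\delta$-far from degree $d$, the tester rejects with probability at least $2/3$.
   Context: Every function $f:\mathbb{F}_q^n\to\mathbb{F}_q$ has a unique polynomial representation $f(x)=\sum_{e\in\{0,\dots,q-1\}^n} C_e x^e$ with $x^e=\prod_i x_i^{e_i}$; its degree is $\max\{|e|_1 : C_e\neq 0\}$ where $|e|_1=\sum_i e_i$. For $f,g$ on $\mathbb{F}_q^n$, $\delta(f,g)=\Pr_{x\in\mathbb{F}_q^n}[f(x)\neq g(x)]$ (uniform $x$), and $f$ is $\delta$-far from degree $d$ if $\min_{g:\deg g\le d}\delta(f,g)\geq \delta$. The $t$-online-erasure model: a (randomized, adaptive) tester receives parameters $n,d,\delta,t$ and query access to $f$. Initially no entry of the truth table of $f$ is erased. The tester queries points $x$ one at a time; after each query, an adversary (who may know all queries so far) may erase any $t$ entries of the truth table of $f$. A query to an erased point returns the symbol $\perp$; otherwise it returns $f(x)$. A tester is $t$-online-erasure-resilient if its completeness and soundness guarantees hold against every such adversary. The query complexity is the number of queries made. *)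

theory Defs
  imports "HOL-Probability.Probability" "HOL-Computational_Algebra.Primes"
begin

definition Fpn :: "nat \<Rightarrow> nat \<Rightarrow> nat list set" where
  "Fpn p n = {x. length x = n \<and> (\<forall>i\<in>set x. i < p)}"

(* f is a function F_p^n -> F_p (values outside the domain are irrelevant) *)
definition is_fn :: "nat \<Rightarrow> nat \<Rightarrow> (nat list \<Rightarrow> nat) \<Rightarrow> bool" where
  "is_fn p n f \<longleftrightarrow> (\<forall>x\<in>Fpn p n. f x < p)"

definition mono_eval :: "nat list \<Rightarrow> nat list \<Rightarrow> nat" where
  "mono_eval x e = (\<Prod>i<length x. (x ! i) ^ (e ! i))"

(* degree of the unique representation with exponents in {0..p-1}^n is at most d *)
definition deg_le :: "nat \<Rightarrow> nat \<Rightarrow> nat \<Rightarrow> (nat list \<Rightarrow> nat) \<Rightarrow> bool" where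
  "deg_le p n d f \<longleftrightarrow> (\<exists>C :: nat list \<Rightarrow> nat. \<forall>x\<in>Fpn p n.
      f x = (\<Sum>e\<in>Fpn p n. if sum_list e \<le> d then C e * mono_eval x e else 0) mod p)"

definition rel_dist :: "nat \<Rightarrow> nat \<Rightarrow> (nat list \<Rightarrow> nat) \<Rightarrow> (nat list \<Rightarrow> nat) \<Rightarrow> real" where
  "rel_dist p n f g = real (card {x\<in>Fpn p n. f x \<noteq> g x}) / real (card (Fpn p n))"

definition far_from_deg :: "nat \<Rightarrow> nat \<Rightarrow> nat \<Rightarrow> real \<Rightarrow> (nat list \<Rightarrow> nat) \<Rightarrow> bool" where
  "far_from_deg p n d \<delta> f \<longleftrightarrow> (\<forall>g. is_fn p n g \<and> deg_le p n d g \<longrightarrow> rel_dist p n f g \<ge> \<delta>)"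

(* Tester actions; answers are nat option, None = erased symbol *)
datatype action = Query "nat list" | Decide bool

type_synonym hist = "(nat list \<times> nat option) list"

(* Randomized adaptive tester: history \<Rightarrow> distribution of next action.
   Adversary: history (all queries and answers so far) \<Rightarrow> set of points to erase
   after the latest query. E = set of currently erased points; k = remaining query budget. *)
fun exec :: "(hist \<Rightarrow> action pmf) \<Rightarrow> (hist \<Rightarrow> nat list set) \<Rightarrow> (nat list \<Rightarrow> nat)
             \<Rightarrow> nat list set \<Rightarrow> hist \<Rightarrow> nat \<Rightarrow> bool pmf" where
  "exec T A f E h 0 = map_pmf (\<lambda>a. case a of Decide b \<Rightarrow> b | Query _ \<Rightarrow> False) (T h)"
| "exec T A f E h (Suc k) = bind_pmf (T h) (\<lambda>a. case a of
      Decide b \<Rightarrow> return_pmf b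
    | Query x \<Rightarrow> (let ans = (if x \<in> E then None else Some (f x));
                     h' = h @ [(x, ans)]
                 in exec T A f (E \<union> A h') h' k))"

definition valid_adversary :: "nat \<Rightarrow> (hist \<Rightarrow> nat list set) \<Rightarrow> bool" where
  "valid_adversary t A \<longleftrightarrow> (\<forall>h. finite (A h) \<and> card (A h) \<le> t)"

definition query_bounded :: "(hist \<Rightarrow> action pmf) \<Rightarrow> nat \<Rightarrow> bool" where
  "query_bounded T q \<longleftrightarrow> (\<forall>h. length h \<ge> q \<longrightarrow> (\<forall>a\<in>set_pmf (T h). \<exists>b. a = Decide b))"

definition accept_prob :: "(hist \<Rightarrow> action pmf) \<Rightarrow> nat \<Rightarrow> (hist \<Rightarrow> nat list set) \<Rightarrow> (nat list \<Rightarrow> nat) \<Rightarrow> real" where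
  "accept_prob T q A f = measure_pmf.prob (exec T A f {} [] q) {True}"

definition reject_prob :: "(hist \<Rightarrow> action pmf) \<Rightarrow> nat \<Rightarrow> (hist \<Rightarrow> nat list set) \<Rightarrow> (nat list \<Rightarrow> nat) \<Rightarrow> real" where
  "reject_prob T q A f = measure_pmf.prob (exec T A f {} [] q) {False}"

end

theory Submission
  imports
    Defs
    "HOL-Library.NList"
    "HOL-Library.Function_Algebras"
    "HOL-Number_Theory.Cong"
    "HOL-Computational_Algebra.Polynomial"
    "HOL-Real_Asymp.Real_Asymp"
begin

text \<open>
  Over a prime field, degree at most \<open>d\<close> means that all \<open>(d + 1)\<close>-fold additive differences vanish.
  Testing a random such difference has soundness linear in the distance: if it rejects rarely,
  then taking the plurality vote of \<open>f x \<mp> \<Delta>\<^sub>h f x\<close> over random directions \<open>h\<close> corrects \<open>f\<close> to a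
  nearby function all of whose differences vanish.

  To resist erasures, a block of queries consists of uniform points in the image of a random
  affine map \<open>F\<^sub>p\<^sup>r \<rightarrow> F\<^sub>p\<^sup>n\<close> with \<open>p\<^sup>r\<close> polynomial in \<open>t / \<delta>\<close>, so that erased points are rarely hit.
  A constant multiple of the number of monomials of such points determines a polynomial of degree
  \<open>d\<close> on \<open>F\<^sub>p\<^sup>r\<close>, and one further point then reveals a disagreement with probability at least the
  distance. Repeating \<open>O(1 / \<delta>)\<close> blocks and accepting iff some polynomial of degree \<open>d\<close> fits all
  answers gives the tester. If \<open>n\<close> is too small for such an \<open>r\<close>, then \<open>r = max n (d + 1)\<close> still
  works, because the exponent \<open>1 / (20 d)\<close> in the bound on \<open>t\<close> leaves enough room.
\<close>

section \<open>Averages over finite sets\<close>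

definition avg :: "'a set \<Rightarrow> ('a \<Rightarrow> real) \<Rightarrow> real" where
  "avg S \<phi> = (\<Sum>x\<in>S. \<phi> x) / real (card S)"

abbreviation proportion :: "'a set \<Rightarrow> ('a \<Rightarrow> bool) \<Rightarrow> real" where
  "proportion S P \<equiv> avg S (\<lambda>x. of_bool (P x))"

lemma avg_cong: "(\<And>x. x \<in> S \<Longrightarrow> \<phi> x = \<psi> x) \<Longrightarrow> avg S \<phi> = avg S \<psi>"
  by (simp add: avg_def)

lemma avg_mono: "(\<And>x. x \<in> S \<Longrightarrow> \<phi> x \<le> \<psi> x) \<Longrightarrow> avg S \<phi> \<le> avg S \<psi>"
  by (simp add: avg_def divide_right_mono sum_mono)

lemma avg_nonneg: "(\<And>x. x \<in> S \<Longrightarrow> 0 \<le> \<phi> x) \<Longrightarrow> 0 \<le> avg S \<phi>"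
  by (simp add: avg_def sum_nonneg)

lemma avg_add: "avg S (\<lambda>x. \<phi> x + \<psi> x) = avg S \<phi> + avg S \<psi>"
  by (simp add: avg_def sum.distrib add_divide_distrib)

lemma avg_diff: "avg S (\<lambda>x. \<phi> x - \<psi> x) = avg S \<phi> - avg S \<psi>"
  by (simp add: avg_def sum_subtractf diff_divide_distrib)

lemma avg_cmult: "avg S (\<lambda>x. c * \<phi> x) = c * avg S \<phi>"
  by (simp add: avg_def sum_distrib_left)

lemma avg_sum: "avg S (\<lambda>x. \<Sum>z\<in>Z. \<phi> z x) = (\<Sum>z\<in>Z. avg S (\<phi> z))"
  unfolding avg_def by (subst sum.swap) (simp add: sum_divide_distrib)

lemma avg_const [simp]: "finite S \<Longrightarrow> S \<noteq> {} \<Longrightarrow> avg S (\<lambda>_. c) = c"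
  by (simp add: avg_def)

lemma avg_singleton [simp]: "avg {a} \<phi> = \<phi> a"
  by (simp add: avg_def)

lemma avg_le_const: "finite S \<Longrightarrow> S \<noteq> {} \<Longrightarrow> (\<And>x. x \<in> S \<Longrightarrow> \<phi> x \<le> c) \<Longrightarrow> avg S \<phi> \<le> c"
  using avg_mono[of S \<phi> "\<lambda>_. c"] by simp

lemma ex_le_avg:
  assumes "finite S" "S \<noteq> {}" shows "\<exists>x\<in>S. \<phi> x \<le> avg S \<phi>"
proof (rule ccontr)
  assume "\<not> ?thesis"
  then have "(\<Sum>x\<in>S. avg S \<phi>) < (\<Sum>x\<in>S. \<phi> x)"
    using assms by (intro sum_strict_mono) auto
  then show False using assms by (simp add: avg_def)
qed

lemma avg_swap: "avg A (\<lambda>x. avg B (\<lambda>y. \<phi> x y)) = avg B (\<lambda>y. avg A (\<lambda>x. \<phi> x y))"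
  unfolding avg_def by (simp add: sum_divide_distrib[symmetric]) (subst sum.swap, simp)

lemma avg_Times: "avg (A \<times> B) \<phi> = avg A (\<lambda>x. avg B (\<lambda>y. \<phi> (x, y)))"
  unfolding avg_def
  by (simp add: sum.cartesian_product card_cartesian_product sum_divide_distrib[symmetric])

lemma avg_reindex: "bij_betw h A B \<Longrightarrow> avg B \<phi> = avg A (\<lambda>x. \<phi> (h x))"
  unfolding avg_def by (simp add: sum.reindex_bij_betw bij_betw_same_card)

lemma proportion_eq_card: "finite S \<Longrightarrow> proportion S P = card {x \<in> S. P x} / card S"
  by (simp add: avg_def Int_def)

lemma proportion_le_1: "proportion S P \<le> 1"
proof (cases "finite S \<and> S \<noteq> {}")
  case True
  then show ?thesis by (intro avg_le_const) auto
qed (auto simp: avg_def)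

lemma proportion_not:
  "finite S \<Longrightarrow> S \<noteq> {} \<Longrightarrow> proportion S (\<lambda>x. \<not> P x) = 1 - proportion S P"
  by (simp add: of_bool_not_iff avg_diff)

lemma proportion_mono: "(\<And>x. x \<in> S \<Longrightarrow> P x \<Longrightarrow> Q x) \<Longrightarrow> proportion S P \<le> proportion S Q"
  by (rule avg_mono) auto

lemma proportion_le_add:
  "(\<And>x. x \<in> S \<Longrightarrow> P x \<Longrightarrow> Q x \<or> R x) \<Longrightarrow> proportion S P \<le> proportion S Q + proportion S R"
  unfolding avg_add[symmetric] by (rule avg_mono) auto

lemma proportion_bex_le_sum:
  assumes "finite Z"
  shows "proportion S (\<lambda>x. \<exists>z\<in>Z. P z x) \<le> (\<Sum>z\<in>Z. proportion S (P z))"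
proof -
  have "of_bool (\<exists>z\<in>Z. P z x) \<le> (\<Sum>z\<in>Z. of_bool (P z x) :: real)" for x
  proof (cases "\<exists>z\<in>Z. P z x")
    case True
    then obtain z where "z \<in> Z" "P z x" by blast
    then show ?thesis
      using member_le_sum[of z Z "\<lambda>z. of_bool (P z x) :: real"] assms by auto
  qed (auto intro: sum_nonneg)
  then show ?thesis unfolding avg_sum[symmetric] by (intro avg_mono)
qed

lemma finite_nlists [simp]: "finite A \<Longrightarrow> finite (nlists n A)"
  unfolding nlists_def by (subst conj.commute) (rule finite_lists_length_eq)

lemma card_nlists: "finite A \<Longrightarrow> card (nlists n A) = card A ^ n"
  unfolding nlists_def by (subst conj.commute) (rule card_lists_length_eq)

lemma nlists_eq_empty_iff [simp]: "nlists n A = {} \<longleftrightarrow> A = {} \<and> n > 0"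
  by (cases n) (simp, metis all_not_in_conv in_nlists_Suc_iff nlists_not_empty zero_less_Suc)

lemma avg_nlists_Suc:
  "avg (nlists (Suc k) X) \<phi> = avg X (\<lambda>x. avg (nlists k X) (\<lambda>xs. \<phi> (x # xs)))"
proof -
  have "inj_on (\<lambda>(x, xs). x # xs) (X \<times> nlists k X)"
    by (simp add: inj_on_def split_def prod_eq_iff)
  moreover have "(\<lambda>(x, xs). x # xs) ` (X \<times> nlists k X) = nlists (Suc k) X"
    unfolding nlists_Suc by fast
  ultimately have "bij_betw (\<lambda>(x, xs). x # xs) (X \<times> nlists k X) (nlists (Suc k) X)"
    unfolding bij_betw_def ..
  from avg_reindex[OF this, of \<phi>] show ?thesis by (simp add: avg_Times)
qed

lemma avg_nlists_take:
  assumes "finite X" "X \<noteq> {}" "k \<le> r"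
  shows "avg (nlists r X) (\<lambda>xs. \<phi> (take k xs)) = avg (nlists k X) \<phi>"
  using assms(3)
proof (induction k arbitrary: r \<phi>)
  case 0
  then show ?case using assms by simp
next
  case (Suc k)
  then obtain r' where "r = Suc r'" "k \<le> r'" by (metis Suc_le_D Suc_le_mono)
  then show ?case using Suc.IH[of r' "\<lambda>xs. \<phi> (_ # xs)"] by (simp add: avg_nlists_Suc)
qed

lemma proportion_nlists_all:
  "proportion (nlists m X) (\<lambda>xs. \<forall>x\<in>set xs. P x) = proportion X P ^ m"
proof (induction m)
  case (Suc m)
  have "proportion (nlists (Suc m) X) (\<lambda>xs. \<forall>x\<in>set xs. P x)
      = avg X (\<lambda>x. avg (nlists m X) (\<lambda>xs. of_bool (P x) * of_bool (\<forall>x\<in>set xs. P x)))"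
    by (simp add: avg_nlists_Suc of_bool_conj)
  also have "\<dots> = avg X (\<lambda>x. proportion X P ^ m * of_bool (P x))"
    by (simp only: avg_cmult Suc mult.commute)
  finally show ?case by (simp add: avg_cmult)
qed simp

lemma sum_nlists_snoc:
  "(\<Sum>xs\<in>nlists (Suc n) A. F xs) = (\<Sum>xs\<in>nlists n A. \<Sum>x\<in>A. F (xs @ [x]))"
proof -
  have "inj_on (\<lambda>(xs, x). xs @ [x]) (nlists n A \<times> A)"
    by (simp add: inj_on_def split_def prod_eq_iff)
  moreover have "(\<lambda>(xs, x). xs @ [x]) ` (nlists n A \<times> A) = nlists (Suc n) A"
    unfolding nlists_def by (auto simp: length_Suc_conv_rev image_iff split_def)
  ultimately have "bij_betw (\<lambda>(xs, x). xs @ [x]) (nlists n A \<times> A) (nlists (Suc n) A)"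
    unfolding bij_betw_def ..
  from sum.reindex_bij_betw[OF this, of F] show ?thesis
    by (simp add: sum.cartesian_product case_prod_unfold)
qed

lemma prod_sum_nlists:
  fixes F :: "nat \<Rightarrow> 'a \<Rightarrow> 'b::comm_semiring_1"
  shows "(\<Prod>i<n. \<Sum>a\<in>A. F i a) = (\<Sum>e\<in>nlists n A. \<Prod>i<n. F i (e ! i))"
proof (induction n)
  case (Suc n)
  have "(\<Prod>i<Suc n. F i ((e @ [a]) ! i)) = (\<Prod>i<n. F i (e ! i)) * F n a" if "e \<in> nlists n A" for e a
    using that by (auto simp: nth_append intro!: arg_cong2[where f = "(*)"] prod.cong)
  then have "(\<Sum>e\<in>nlists (Suc n) A. \<Prod>i<Suc n. F i (e ! i))
      = (\<Sum>e\<in>nlists n A. \<Sum>a\<in>A. (\<Prod>i<n. F i (e ! i)) * F n a)"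
    unfolding sum_nlists_snoc by (intro sum.cong refl)
  also have "\<dots> = (\<Sum>e\<in>nlists n A. \<Prod>i<n. F i (e ! i)) * (\<Sum>a\<in>A. F n a)"
    by (rule sum_product[symmetric])
  also have "\<dots> = (\<Prod>i<Suc n. \<Sum>a\<in>A. F i a)"
    by (simp only: Suc prod.lessThan_Suc)
  finally show ?case by (rule sym)
qed simp

section \<open>Iterated differences\<close>

definition difference :: "'a::plus \<Rightarrow> ('a \<Rightarrow> 'b::minus) \<Rightarrow> 'a \<Rightarrow> 'b" where
  "difference h f x = f (x + h) - f x"

definition differences :: "'a::plus list \<Rightarrow> ('a \<Rightarrow> 'b::minus) \<Rightarrow> 'a \<Rightarrow> 'b" where
  "differences hs f = foldr difference hs f"

lemma differences_Nil [simp]: "differences [] f = f"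
  by (simp add: differences_def)

lemma differences_Cons [simp]: "differences (h # hs) f = difference h (differences hs f)"
  by (simp add: differences_def)

lemma differences_append: "differences (as @ bs) f = differences as (differences bs f)"
  by (simp add: differences_def)

lemma difference_commute:
  fixes f :: "'a::ab_semigroup_add \<Rightarrow> 'b::ab_group_add"
  shows "difference a (difference b f) = difference b (difference a f)"
  by (simp add: fun_eq_iff difference_def algebra_simps)

lemma differences_difference:
  fixes f :: "'a::ab_semigroup_add \<Rightarrow> 'b::ab_group_add"
  shows "differences hs (difference h f) = difference h (differences hs f)"
proof (induction hs)
  case (Cons a hs)
  then show ?case by (simp add: difference_commute[of a h])
qed simp

lemma differences_commute:
  fixes f :: "'a::ab_semigroup_add \<Rightarrow> 'b::ab_group_add"
  shows "differences as (differences bs f) = differences bs (differences as f)"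
  by (induction as) (simp_all add: differences_difference)

lemma differences_shift:
  fixes f :: "'a::ab_semigroup_add \<Rightarrow> 'b::minus"
  shows "differences hs (\<lambda>x. f (x + c)) x = differences hs f (x + c)"
  by (induction hs arbitrary: x) (simp_all add: difference_def add.assoc add.commute[of c])

lemma differences_add:
  fixes f g :: "'a::plus \<Rightarrow> 'b::ab_group_add"
  shows "differences hs (\<lambda>x. f x + g x) x = differences hs f x + differences hs g x"
  by (induction hs arbitrary: x) (simp_all add: difference_def)

lemma differences_diff:
  fixes f g :: "'a::plus \<Rightarrow> 'b::ab_group_add"
  shows "differences hs (\<lambda>x. f x - g x) x = differences hs f x - differences hs g x"
  by (induction hs arbitrary: x) (simp_all add: difference_def)

lemma differences_cmult:
  fixes f :: "'a::plus \<Rightarrow> 'b::ring"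
  shows "differences hs (\<lambda>x. c * f x) x = c * differences hs f x"
  by (induction hs arbitrary: x) (simp_all add: difference_def right_diff_distrib)

lemma differences_zero: "differences hs (\<lambda>_. 0) x = (0 :: 'b::ab_group_add)"
  by (induction hs arbitrary: x) (simp_all add: difference_def)

text \<open>Shifting by \<open>u\<close> is \<open>1 + \<Delta>\<^sub>u\<close>.\<close>
lemma newton_expansion:
  fixes g :: "'a::ring_1 \<Rightarrow> int"
  shows "g (x + of_nat a * u) = (\<Sum>j\<le>a. int (a choose j) * differences (replicate j u) g x)"
proof (induction a arbitrary: x)
  case 0
  then show ?case by simp
next
  case (Suc a)
  let ?D = "\<lambda>j. differences (replicate j u) g x"
  have D_shift: "differences (replicate j u) g (x + u) = ?D j + ?D (Suc j)" for j
    by (simp add: difference_def)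
  have "g (x + of_nat (Suc a) * u) = g ((x + u) + of_nat a * u)"
    by (simp add: algebra_simps)
  also have "\<dots> = (\<Sum>j\<le>a. int (a choose j) * ?D j) + (\<Sum>j\<le>a. int (a choose j) * ?D (Suc j))"
    unfolding Suc D_shift distrib_left sum.distrib ..
  also have "(\<Sum>j\<le>a. int (a choose j) * ?D j) = (\<Sum>j\<le>Suc a. int (a choose j) * ?D j)"
    by simp
  also have "\<dots> = ?D 0 + (\<Sum>j\<le>a. int (a choose Suc j) * ?D (Suc j))"
    by (subst sum.atMost_Suc_shift) simp
  also have "\<dots> + (\<Sum>j\<le>a. int (a choose j) * ?D (Suc j))
      = ?D 0 + (\<Sum>j\<le>a. int (Suc a choose Suc j) * ?D (Suc j))"
    by (simp add: sum.distrib distrib_right del: replicate_Suc)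
  also have "\<dots> = (\<Sum>j\<le>Suc a. int (Suc a choose j) * ?D j)"
    by (subst sum.atMost_Suc_shift) simp
  finally show ?case .
qed

fun subset_sums :: "'a::comm_monoid_add list \<Rightarrow> 'a set" where
  "subset_sums [] = {0}"
| "subset_sums (h # hs) = subset_sums hs \<union> (+) h ` subset_sums hs"

fun nonempty_subset_sums :: "'a::comm_monoid_add list \<Rightarrow> 'a set" where
  "nonempty_subset_sums [] = {}"
| "nonempty_subset_sums (h # hs) = nonempty_subset_sums hs \<union> (+) h ` subset_sums hs"

lemma finite_subset_sums [simp]: "finite (subset_sums hs)"
  by (induction hs) auto

lemma card_subset_sums: "card (subset_sums hs) \<le> 2 ^ length hs"
proof (induction hs)
  case (Cons h hs)
  have "card (subset_sums (h # hs)) \<le> card (subset_sums hs) + card ((+) h ` subset_sums hs)"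
    unfolding subset_sums.simps by (rule card_Un_le)
  also have "\<dots> \<le> card (subset_sums hs) + card (subset_sums hs)"
    by (intro add_left_mono card_image_le) simp
  finally show ?case using Cons by simp
qed simp

lemma cong_differences:
  fixes f g :: "'a::comm_monoid_add \<Rightarrow> int"
  assumes "\<And>s. s \<in> subset_sums hs \<Longrightarrow> [f (x + s) = g (x + s)] (mod q)"
  shows "[differences hs f x = differences hs g x] (mod q)"
  using assms
proof (induction hs arbitrary: x)
  case (Cons h hs)
  have "[f (x + h + s) = g (x + h + s)] (mod q)" if "s \<in> subset_sums hs" for s
    using Cons.prems[of "h + s"] that by (simp add: add.assoc)
  then have "[differences hs f (x + h) = differences hs g (x + h)] (mod q)" by (rule Cons.IH)
  moreover have "[differences hs f x = differences hs g x] (mod q)"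
    using Cons.prems by (intro Cons.IH) simp
  ultimately show ?case unfolding differences_Cons difference_def by (rule cong_diff)
qed simp

lemma differences_cong_if_nonempty_sums:
  fixes f :: "'a::comm_monoid_add \<Rightarrow> int"
  assumes "\<And>s. s \<in> nonempty_subset_sums hs \<Longrightarrow> [f (x + s) = 0] (mod q)"
  shows "[differences hs f x = (-1) ^ length hs * f x] (mod q)"
  using assms
proof (induction hs arbitrary: x)
  case (Cons h hs)
  have "[f (x + h + s) = 0] (mod q)" if "s \<in> subset_sums hs" for s
    using Cons.prems[of "h + s"] that by (simp add: add.assoc)
  then have "[differences hs f (x + h) = differences hs (\<lambda>_. 0) (x + h)] (mod q)"
    by (rule cong_differences)
  moreover have "[differences hs f x = (-1) ^ length hs * f x] (mod q)"
    using Cons.prems by (intro Cons.IH) simp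
  ultimately have "[difference h (differences hs f) x = 0 - (-1) ^ length hs * f x] (mod q)"
    unfolding difference_def differences_zero by (rule cong_diff)
  then show ?case by simp
qed simp

definition vanishing_differences :: "int \<Rightarrow> nat \<Rightarrow> ('a::ab_group_add \<Rightarrow> int) \<Rightarrow> bool" where
  "vanishing_differences q k f \<longleftrightarrow> (\<forall>hs x. length hs = k \<longrightarrow> [differences hs f x = 0] (mod q))"

lemma vanishing_differences_0: "vanishing_differences q 0 f \<longleftrightarrow> (\<forall>x. [f x = 0] (mod q))"
  by (simp add: vanishing_differences_def)

lemma vanishing_differences_Suc:
  "vanishing_differences q (Suc k) f \<longleftrightarrow> (\<forall>h. vanishing_differences q k (difference h f))"
proof -
  have "(\<forall>hs. length hs = Suc k \<longrightarrow> (\<forall>x. [differences hs f x = 0] (mod q))) \<longleftrightarrow>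
      (\<forall>h hs. length hs = k \<longrightarrow> (\<forall>x. [differences (h # hs) f x = 0] (mod q)))"
    unfolding length_Suc_conv by blast
  then show ?thesis by (auto simp: vanishing_differences_def differences_difference)
qed

lemma vanishing_differences_cong:
  assumes "\<And>x. [f x = g x] (mod q)"
  shows "vanishing_differences q k f \<longleftrightarrow> vanishing_differences q k g"
proof -
  have "q dvd differences hs f x \<longleftrightarrow> q dvd differences hs g x" for hs x
    by (intro cong_dvd_iff cong_differences assms)
  then show ?thesis by (simp add: vanishing_differences_def cong_0_iff)
qed

lemma vanishing_differences_zero: "vanishing_differences q k (\<lambda>_. 0)"
  by (simp add: vanishing_differences_def differences_zero)

lemma vanishing_differences_if_cong_0:
  "(\<And>x. [f x = 0] (mod q)) \<Longrightarrow> vanishing_differences q k f"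
  using vanishing_differences_cong[of f "\<lambda>_. 0" q k] vanishing_differences_zero by simp

lemma vanishing_differences_add:
  "vanishing_differences q k f \<Longrightarrow> vanishing_differences q k g \<Longrightarrow>
   vanishing_differences q k (\<lambda>x. f x + g x)"
  unfolding vanishing_differences_def by (simp add: differences_add cong_0_iff)

lemma vanishing_differences_diff:
  "vanishing_differences q k f \<Longrightarrow> vanishing_differences q k g \<Longrightarrow>
   vanishing_differences q k (\<lambda>x. f x - g x)"
  unfolding vanishing_differences_def by (simp add: differences_diff cong_0_iff)

lemma vanishing_differences_cmult:
  "vanishing_differences q k f \<Longrightarrow> vanishing_differences q k (\<lambda>x. c * f x)"
  unfolding vanishing_differences_def by (simp add: differences_cmult cong_0_iff)

lemma vanishing_differences_sum:
  "(\<And>e. e \<in> S \<Longrightarrow> vanishing_differences q k (f e)) \<Longrightarrow>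
   vanishing_differences q k (\<lambda>x. \<Sum>e\<in>S. f e x)"
  by (induction S rule: infinite_finite_induct)
    (simp_all add: vanishing_differences_zero vanishing_differences_add)

lemma vanishing_differences_shift:
  "vanishing_differences q k f \<Longrightarrow> vanishing_differences q k (\<lambda>x. f (x + c))"
  by (simp add: vanishing_differences_def differences_shift)

lemma vanishing_differences_mono:
  "vanishing_differences q k f \<Longrightarrow> k \<le> l \<Longrightarrow> vanishing_differences q l f"
proof (induction k arbitrary: f l)
  case 0
  then show ?case
    by (intro vanishing_differences_if_cong_0) (simp add: vanishing_differences_0)
next
  case (Suc k)
  then obtain m where m: "l = Suc m" "k \<le> m" by (metis Suc_le_D Suc_le_mono)
  show ?case
    using Suc.prems(1) m(2) unfolding m(1) vanishing_differences_Suc by (blast intro: Suc.IH)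
qed

lemma vanishing_differences_mult:
  "vanishing_differences q a f \<Longrightarrow> vanishing_differences q b g \<Longrightarrow>
   vanishing_differences q (a + b - 1) (\<lambda>x. f x * g x)"
proof (induction "a + b" arbitrary: a b f g rule: less_induct)
  case less
  show ?case
  proof (cases "a = 0 \<or> b = 0")
    case True
    then show ?thesis using less.prems
      by (intro vanishing_differences_if_cong_0) (auto simp: vanishing_differences_0 cong_0_iff)
  next
    case False
    then obtain a' b' where ab: "a = Suc a'" "b = Suc b'" by (metis not0_implies_Suc)
    have "vanishing_differences q (a' + b') (difference h (\<lambda>x. f x * g x))" for h
    proof -
      have "vanishing_differences q (a' + Suc b' - 1) (\<lambda>x. difference h f x * g (x + h))"
        using less.prems unfolding ab vanishing_differences_Suc[of _ a']
        by (intro less.hyps) (auto simp: ab intro: vanishing_differences_shift)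
      moreover have "vanishing_differences q (Suc a' + b' - 1) (\<lambda>x. f x * difference h g x)"
        using less.prems unfolding ab vanishing_differences_Suc[of _ b']
        by (intro less.hyps) (auto simp: ab)
      moreover have "difference h (\<lambda>x. f x * g x)
          = (\<lambda>x. difference h f x * g (x + h) + f x * difference h g x)"
        by (simp add: fun_eq_iff difference_def algebra_simps)
      ultimately show ?thesis by (simp add: vanishing_differences_add)
    qed
    then show ?thesis by (simp add: ab vanishing_differences_Suc)
  qed
qed

lemma vanishing_differences_const: "vanishing_differences q (Suc 0) (\<lambda>_. c)"
  by (simp add: vanishing_differences_Suc vanishing_differences_0 difference_def)

lemma vanishing_differences_power:
  "vanishing_differences q 2 f \<Longrightarrow> vanishing_differences q (Suc e) (\<lambda>x. f x ^ e)"
proof (induction e)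
  case 0
  then show ?case by (simp add: vanishing_differences_const)
next
  case (Suc e)
  then show ?case using vanishing_differences_mult[of q 2 f "Suc e" "\<lambda>x. f x ^ e"] by simp
qed

lemma vanishing_differences_prod:
  fixes f :: "nat \<Rightarrow> 'a::ab_group_add \<Rightarrow> int"
  assumes "\<And>i. vanishing_differences q (Suc (e i)) (f i)"
  shows "vanishing_differences q (Suc (\<Sum>i<n. e i)) (\<lambda>x. \<Prod>i<n. f i x)"
proof (induction n)
  case 0
  then show ?case by (simp add: vanishing_differences_const)
next
  case (Suc n)
  then show ?case using vanishing_differences_mult[OF Suc assms[of n]] by simp
qed

section \<open>Local testability of vanishing differences\<close>

definition vote :: "'a::ab_group_add list \<Rightarrow> ('a \<Rightarrow> int) \<Rightarrow> 'a \<Rightarrow> int" where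
  "vote hs f x = f x - (-1) ^ length hs * differences hs f x"

lemma differences_vote: "differences hs (vote as f) = vote as (differences hs f)"
  by (rule ext)
    (simp add: vote_def[abs_def] differences_diff differences_cmult differences_commute[of as])

lemma vote_cong_0:
  assumes "\<And>s. s \<in> nonempty_subset_sums hs \<Longrightarrow> [f (x + s) = 0] (mod q)"
  shows "[vote hs f x = 0] (mod q)"
proof -
  have "[f x - (-1) ^ length hs * differences hs f x
      = f x - (-1) ^ length hs * ((-1) ^ length hs * f x)] (mod q)"
    using assms by (intro cong_diff cong_scalar_left differences_cong_if_nonempty_sums) auto
  then show ?thesis by (simp add: vote_def)
qed

lemma proportion_differences_Cons_disagree_le:
  fixes f :: "'a::ab_group_add \<Rightarrow> int"
  shows "proportion S (\<lambda>hs. [differences (h # hs) f x \<noteq> differences (h' # hs') f x] (mod q))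
    \<le> proportion S (\<lambda>hs. [differences hs (difference (h + - h') f) (x + h') \<noteq> 0] (mod q))
      + proportion S (\<lambda>hs. [differences hs (difference h' f) x
          \<noteq> differences hs' (difference h' f) x] (mod q))"
proof (rule proportion_le_add)
  fix hs :: "'a list"
  have "differences (h # hs) f x - differences (h' # hs') f x
      = differences hs (difference (h + - h') f) (x + h')
      + (differences hs (difference h' f) x - differences hs' (difference h' f) x)"
    by (simp add: differences_difference) (simp add: difference_def algebra_simps)
  then show "[differences hs (difference (h + - h') f) (x + h') \<noteq> 0] (mod q) \<or>
      [differences hs (difference h' f) x \<noteq> differences hs' (difference h' f) x] (mod q)"
    if "[differences (h # hs) f x \<noteq> differences (h' # hs') f x] (mod q)"
    using that by (auto simp: cong_iff_dvd_diff)
qed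

definition robustness :: "nat \<Rightarrow> real" where
  "robustness k = 1 / (2 ^ k * (real k + 2 ^ k))"

lemma robustness_denom_pos: "0 < (2::real) ^ k * (real k + 2 ^ k)"
  by (intro mult_pos_pos add_nonneg_pos) auto

lemma robustness_pos: "0 < robustness k"
  unfolding robustness_def using robustness_denom_pos by simp

lemma less_robustness_iff: "\<epsilon> < robustness k \<longleftrightarrow> 2 ^ k * ((real k + 2 ^ k) * \<epsilon>) < 1"
  unfolding robustness_def pos_less_divide_eq[OF robustness_denom_pos] by (simp add: mult_ac)

lemma robustness_le_half: "robustness (Suc k) \<le> 1 / 2"
proof -
  have "(2::real) * 1 \<le> 2 ^ Suc k * (real (Suc k) + 2 ^ Suc k)"
    by (intro mult_mono) auto
  then show ?thesis unfolding robustness_def by (intro divide_left_mono) auto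
qed

locale reduction =
  fixes X :: "'a::ab_group_add set" and red :: "'a \<Rightarrow> 'a"
  assumes finite_X [simp]: "finite X"
    and red_in [simp]: "red a \<in> X"
    and red_id: "x \<in> X \<Longrightarrow> red x = x"
    and red_add: "red (red a + b) = red (a + b)"
begin

lemma X_nonempty [simp]: "X \<noteq> {}"
  using red_in by blast

lemma red_red [simp]: "red (red a) = red a"
  by (simp add: red_id)

lemma red_add_right: "red (a + red b) = red (a + b)"
  using red_add[of b a] by (simp add: add.commute)

lemma bij_betw_shift: "bij_betw (\<lambda>x. red (x + c)) X X"
proof (rule bij_betw_byWitness[where f' = "\<lambda>x. red (x - c)"])
  show "\<forall>a\<in>X. red (red (a + c) - c) = a"
    using red_add[of "_ + c" "- c"] by (auto simp: red_id)
  show "\<forall>a\<in>X. red (red (a - c) + c) = a"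
    by (auto simp: red_id red_add)
qed auto

definition periodic :: "('a \<Rightarrow> 'b) \<Rightarrow> bool" where
  "periodic \<phi> \<longleftrightarrow> (\<forall>x. \<phi> (red x) = \<phi> x)"

lemma avg_shift: "periodic \<phi> \<Longrightarrow> avg X (\<lambda>x. \<phi> (x + c)) = avg X \<phi>"
  using avg_reindex[OF bij_betw_shift[of c], of \<phi>] by (simp add: periodic_def)

lemma proportion_shift: "periodic P \<Longrightarrow> proportion X (\<lambda>x. P (x + c)) = proportion X P"
  using avg_shift[of "\<lambda>x. of_bool (P x)"] by (simp add: periodic_def)

definition periodic_mod :: "int \<Rightarrow> ('a \<Rightarrow> int) \<Rightarrow> bool" where
  "periodic_mod q f \<longleftrightarrow> (\<forall>x. [f (red x) = f x] (mod q))"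

lemma periodic_mod_cong_if_red_eq:
  "periodic_mod q f \<Longrightarrow> red x = red y \<Longrightarrow> [f x = f y] (mod q)"
  unfolding periodic_mod_def cong_def by metis

lemma periodic_mod_diff:
  "periodic_mod q f \<Longrightarrow> periodic_mod q g \<Longrightarrow> periodic_mod q (\<lambda>x. f x - g x)"
  by (simp add: periodic_mod_def cong_diff)

lemma periodic_mod_difference:
  assumes "periodic_mod q f" shows "periodic_mod q (difference h f)"
  unfolding periodic_mod_def difference_def
  by (intro allI cong_diff periodic_mod_cong_if_red_eq[OF assms] red_add red_red)

lemma periodic_mod_differences: "periodic_mod q f \<Longrightarrow> periodic_mod q (differences hs f)"
  by (induction hs) (simp_all add: periodic_mod_difference)

lemma periodic_cong_0: "periodic_mod q f \<Longrightarrow> periodic (\<lambda>x. [f x = 0] (mod q))"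
  by (simp add: periodic_mod_def periodic_def cong_def)

lemma periodic_differences_head:
  assumes "periodic_mod q f"
  shows "periodic (\<lambda>h. [differences (h # hs) f x = 0] (mod q))"
proof -
  have "[differences (red h # hs) f x = differences (h # hs) f x] (mod q)" for h
    unfolding differences_Cons difference_def
    by (intro cong_diff cong_refl
        periodic_mod_cong_if_red_eq[OF periodic_mod_differences[OF assms]]) (rule red_add_right)
  then show ?thesis by (simp add: periodic_def cong_def)
qed

definition dist_mod :: "int \<Rightarrow> ('a \<Rightarrow> int) \<Rightarrow> ('a \<Rightarrow> int) \<Rightarrow> real" where
  "dist_mod q f g = proportion X (\<lambda>x. [f x \<noteq> g x] (mod q))"

definition low_degree :: "int \<Rightarrow> nat \<Rightarrow> ('a \<Rightarrow> int) \<Rightarrow> bool" where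
  "low_degree q d g \<longleftrightarrow> periodic_mod q g \<and> vanishing_differences q (Suc d) g"

lemma low_degree_diff:
  "low_degree q d f \<Longrightarrow> low_degree q d g \<Longrightarrow> low_degree q d (\<lambda>x. f x - g x)"
  by (simp add: low_degree_def periodic_mod_diff vanishing_differences_diff)

lemma low_degree_cong:
  assumes "\<And>x. [f x = g x] (mod q)"
  shows "low_degree q d f \<longleftrightarrow> low_degree q d g"
proof -
  have "periodic_mod q f \<longleftrightarrow> periodic_mod q g"
    using assms by (simp add: periodic_mod_def cong_def)
  then show ?thesis
    unfolding low_degree_def using vanishing_differences_cong[of f g q "Suc d"] assms by blast
qed

definition nonvanishing_at :: "int \<Rightarrow> nat \<Rightarrow> ('a \<Rightarrow> int) \<Rightarrow> 'a \<Rightarrow> real" where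
  "nonvanishing_at q k f x = proportion (nlists k X) (\<lambda>hs. [differences hs f x \<noteq> 0] (mod q))"

definition nonvanishing_prob :: "int \<Rightarrow> nat \<Rightarrow> ('a \<Rightarrow> int) \<Rightarrow> real" where
  "nonvanishing_prob q k f = avg X (nonvanishing_at q k f)"

lemma nonvanishing_prob_nonneg: "0 \<le> nonvanishing_prob q k f"
  unfolding nonvanishing_prob_def nonvanishing_at_def by (intro avg_nonneg) simp

lemma nonvanishing_at_Suc:
  "nonvanishing_at q (Suc k) f x = avg X (\<lambda>h. nonvanishing_at q k (difference h f) x)"
  by (simp add: nonvanishing_at_def avg_nlists_Suc differences_difference)

lemma nonvanishing_prob_Suc:
  "nonvanishing_prob q (Suc k) f = avg X (\<lambda>h. nonvanishing_prob q k (difference h f))"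
  unfolding nonvanishing_prob_def nonvanishing_at_Suc[abs_def] by (rule avg_swap)

lemma avg_nonvanishing_at_shift:
  assumes "periodic_mod q f"
  shows "avg X (\<lambda>x. nonvanishing_at q k f (x + c)) = nonvanishing_prob q k f"
proof -
  have "periodic (nonvanishing_at q k f)"
    unfolding periodic_def nonvanishing_at_def
    using periodic_cong_0[OF periodic_mod_differences[OF assms]] by (simp add: periodic_def)
  then show ?thesis unfolding nonvanishing_prob_def by (rule avg_shift)
qed

lemma avg_nonvanishing_at_difference_shift:
  assumes "periodic_mod q f"
  shows "avg X (\<lambda>h. nonvanishing_at q k (difference (h + c) f) x) = nonvanishing_at q (Suc k) f x"
proof -
  have "avg X (\<lambda>h. nonvanishing_at q k (difference (h + c) f) x)
      = avg (nlists k X) (\<lambda>hs. proportion X (\<lambda>h. [differences ((h + c) # hs) f x \<noteq> 0] (mod q)))"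
    unfolding nonvanishing_at_def by (subst avg_swap) (simp add: differences_difference)
  also have "\<dots> = avg (nlists k X) (\<lambda>hs. proportion X (\<lambda>h. [differences (h # hs) f x \<noteq> 0] (mod q)))"
    using periodic_differences_head[OF assms]
    by (intro avg_cong proportion_shift) (simp add: periodic_def)
  also have "\<dots> = nonvanishing_at q (Suc k) f x"
    unfolding nonvanishing_at_def avg_nlists_Suc by (rule avg_swap)
  finally show ?thesis .
qed

text \<open>Writing \<open>h = (u + h) - u\<close> for a random \<open>u\<close> makes both directions uniform.\<close>
lemma nonvanishing_prob_difference_le:
  assumes "periodic_mod q f"
  shows "nonvanishing_prob q k (difference h f) \<le> 2 * nonvanishing_prob q (Suc k) f"
proof -
  have "nonvanishing_at q k (difference h f) y
      \<le> nonvanishing_at q k (difference (u + h) f) y + nonvanishing_at q k (difference u f) (y + h)"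
    for u y
    unfolding nonvanishing_at_def
  proof (rule proportion_le_add)
    fix hs :: "'a list"
    have "differences hs (difference h f) y
        = differences hs (difference (u + h) f) y - differences hs (difference u f) (y + h)"
      by (simp add: differences_difference) (simp add: difference_def algebra_simps)
    then show "[differences hs (difference (u + h) f) y \<noteq> 0] (mod q) \<or>
        [differences hs (difference u f) (y + h) \<noteq> 0] (mod q)"
      if "[differences hs (difference h f) y \<noteq> 0] (mod q)"
      using that by (auto simp: cong_0_iff)
  qed
  then have "avg X (\<lambda>u. nonvanishing_at q k (difference h f) y)
      \<le> avg X (\<lambda>u. nonvanishing_at q k (difference (u + h) f) y
          + nonvanishing_at q k (difference u f) (y + h))"
    for y
    by (rule avg_mono)
  then have "nonvanishing_at q k (difference h f) y
      \<le> nonvanishing_at q (Suc k) f y + nonvanishing_at q (Suc k) f (y + h)" for y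
    by (simp add: avg_add avg_nonvanishing_at_difference_shift[OF assms] flip: nonvanishing_at_Suc)
  then have "nonvanishing_prob q k (difference h f)
      \<le> avg X (\<lambda>y. nonvanishing_at q (Suc k) f y + nonvanishing_at q (Suc k) f (y + h))"
    unfolding nonvanishing_prob_def[of q k] by (rule avg_mono)
  also have "\<dots> = 2 * nonvanishing_prob q (Suc k) f"
    unfolding avg_add avg_nonvanishing_at_shift[OF assms] nonvanishing_prob_def[symmetric] by simp
  finally show ?thesis .
qed

lemma nonvanishing_fixed_directions:
  "periodic_mod q f \<Longrightarrow>
   proportion X (\<lambda>y. [differences hs f y \<noteq> 0] (mod q))
     \<le> 2 ^ length hs * nonvanishing_prob q (length hs) f"
proof (induction hs arbitrary: f)
  case Nil
  show ?case by (simp add: nonvanishing_prob_def nonvanishing_at_def[abs_def])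
next
  case (Cons h hs)
  have "proportion X (\<lambda>y. [differences (h # hs) f y \<noteq> 0] (mod q))
      \<le> 2 ^ length hs * nonvanishing_prob q (length hs) (difference h f)"
    using Cons.IH[OF periodic_mod_difference[OF Cons.prems]] by (simp add: differences_difference)
  also have "\<dots> \<le> 2 ^ length hs * (2 * nonvanishing_prob q (Suc (length hs)) f)"
    using nonvanishing_prob_difference_le[OF Cons.prems] by (intro mult_left_mono) auto
  finally show ?case by simp
qed

lemma avg_differences_disagree_le:
  assumes "periodic_mod q f"
  shows "avg (nlists k X) (\<lambda>hs'. proportion (nlists k X)
      (\<lambda>hs. [differences hs f x \<noteq> differences hs' f x] (mod q))) \<le> k * nonvanishing_prob q k f"
  using assms
proof (induction k arbitrary: f)
  case 0
  show ?case by simp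
next
  case (Suc k)
  let ?L = "nlists k X"
  let ?N = "\<lambda>h' hs'. proportion ?L (\<lambda>hs. [differences hs (difference h' f) x
      \<noteq> differences hs' (difference h' f) x] (mod q))"
  have "avg (nlists (Suc k) X) (\<lambda>hs'. proportion (nlists (Suc k) X)
      (\<lambda>hs. [differences hs f x \<noteq> differences hs' f x] (mod q)))
    \<le> avg X (\<lambda>h'. avg ?L (\<lambda>hs'. avg X (\<lambda>h.
        nonvanishing_at q k (difference (h + - h') f) (x + h') + ?N h' hs')))"
    unfolding avg_nlists_Suc nonvanishing_at_def
    by (intro avg_mono proportion_differences_Cons_disagree_le)
  also have "\<dots> = avg X (\<lambda>h'. nonvanishing_at q (Suc k) f (h' + x) + avg ?L (?N h'))"
    by (simp add: avg_add add.commute[of x]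
        avg_nonvanishing_at_difference_shift[OF Suc.prems, of k "- _", simplified])
  also have "\<dots> \<le> avg X (\<lambda>h'. nonvanishing_at q (Suc k) f (h' + x)
      + k * nonvanishing_prob q k (difference h' f))"
    by (intro avg_mono add_left_mono Suc.IH periodic_mod_difference Suc.prems)
  also have "\<dots> = Suc k * nonvanishing_prob q (Suc k) f"
    by (simp add: avg_add avg_cmult avg_nonvanishing_at_shift[OF Suc.prems] distrib_right
        flip: nonvanishing_prob_Suc)
  finally show ?case .
qed

definition plurality :: "int \<Rightarrow> nat \<Rightarrow> ('a \<Rightarrow> int) \<Rightarrow> ('a \<Rightarrow> int) \<Rightarrow> bool" where
  "plurality q k f g \<longleftrightarrow> (\<forall>x. proportion (nlists k X) (\<lambda>hs. [g x \<noteq> vote hs f x] (mod q))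
     \<le> k * nonvanishing_prob q k f)"

lemma ex_plurality:
  assumes "periodic_mod q f"
  shows "\<exists>g. periodic_mod q g \<and> plurality q k f g"
proof -
  let ?L = "nlists k X"
  have "\<exists>hs'\<in>?L. proportion ?L (\<lambda>hs. [differences hs f x \<noteq> differences hs' f x] (mod q))
      \<le> k * nonvanishing_prob q k f" for x
  proof -
    have "\<exists>hs'\<in>?L. proportion ?L (\<lambda>hs. [differences hs f x \<noteq> differences hs' f x] (mod q))
      \<le> avg ?L (\<lambda>hs'. proportion ?L (\<lambda>hs. [differences hs f x \<noteq> differences hs' f x] (mod q)))"
      by (rule ex_le_avg) simp_all
    then show ?thesis using avg_differences_disagree_le[OF assms, of k x] by (meson order_trans)
  qed
  then obtain best where best: "best x \<in> ?L"
    "proportion ?L (\<lambda>hs. [differences hs f x \<noteq> differences (best x) f x] (mod q))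
      \<le> k * nonvanishing_prob q k f" for x
    by metis
  define g where "g x = vote (best (red x)) f (red x)" for x
  have "[g x = vote hs f x] (mod q)"
    if "hs \<in> ?L" "[differences hs f (red x) = differences (best (red x)) f (red x)] (mod q)"
    for x hs
  proof -
    have "length (best (red x)) = length hs" using that(1) best(1)[of "red x"] by simp
    then have "[g x = vote hs f (red x)] (mod q)"
      unfolding g_def vote_def
      by (simp only:) (intro cong_diff cong_scalar_left cong_refl that(2)[THEN cong_sym])
    also have "[vote hs f (red x) = vote hs f x] (mod q)"
      using assms periodic_mod_differences[OF assms, of hs]
      unfolding vote_def periodic_mod_def by (intro cong_diff cong_scalar_left) auto
    finally show ?thesis .
  qed
  then have "proportion ?L (\<lambda>hs. [g x \<noteq> vote hs f x] (mod q)) \<le> proportion ?L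
      (\<lambda>hs. [differences hs f (red x) \<noteq> differences (best (red x)) f (red x)] (mod q))" for x
    by (intro proportion_mono) blast
  then have "plurality q k f g"
    unfolding plurality_def by (intro allI order_trans[OF _ best(2)])
  moreover have "periodic_mod q g" by (simp add: periodic_mod_def g_def)
  ultimately show ?thesis by blast
qed

lemma proportion_hits_subset_sums:
  assumes "periodic B"
  shows "proportion X (\<lambda>x. \<exists>s\<in>subset_sums hs. B (x + (c + s))) \<le> 2 ^ length hs * proportion X B"
proof -
  have "proportion X (\<lambda>x. \<exists>s\<in>subset_sums hs. B (x + (c + s)))
      \<le> (\<Sum>s\<in>subset_sums hs. proportion X (\<lambda>x. B (x + (c + s))))"
    by (rule proportion_bex_le_sum) simp
  also have "\<dots> = card (subset_sums hs) * proportion X B"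
    by (simp add: proportion_shift[OF assms])
  also have "\<dots> \<le> 2 ^ length hs * proportion X B"
    using card_subset_sums[of hs] by (simp add: mult_right_mono avg_nonneg flip: of_nat_le_iff)
  finally show ?thesis .
qed

lemma proportion_hits_nonempty_subset_sums:
  assumes "periodic B"
  shows "proportion (nlists k X) (\<lambda>hs. \<exists>s\<in>nonempty_subset_sums hs. B (x + s))
    \<le> 2 ^ k * proportion X B"
proof (induction k)
  case 0
  show ?case by (auto intro: avg_nonneg)
next
  case (Suc k)
  let ?L = "nlists k X"
  have "proportion (nlists (Suc k) X) (\<lambda>hs. \<exists>s\<in>nonempty_subset_sums hs. B (x + s))
    = avg ?L (\<lambda>hs. proportion X (\<lambda>h. \<exists>s\<in>nonempty_subset_sums (h # hs). B (x + s)))"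
    unfolding avg_nlists_Suc by (rule avg_swap)
  also have "\<dots> \<le> avg ?L (\<lambda>hs. proportion X (\<lambda>h. \<exists>s\<in>subset_sums hs. B (h + (x + s))) +
      proportion X (\<lambda>h. \<exists>s\<in>nonempty_subset_sums hs. B (x + s)))"
    by (intro avg_mono proportion_le_add) (auto simp: add.left_commute)
  also have "\<dots> \<le> avg ?L (\<lambda>hs. 2 ^ k * proportion X B
      + of_bool (\<exists>s\<in>nonempty_subset_sums hs. B (x + s)))"
  proof (intro avg_mono add_mono)
    show "proportion X (\<lambda>h. \<exists>s\<in>subset_sums hs. B (h + (x + s))) \<le> 2 ^ k * proportion X B"
      if "hs \<in> ?L" for hs
      using proportion_hits_subset_sums[OF assms, of hs x] that by simp
  qed simp
  also have "\<dots> = 2 ^ k * proportion X B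
      + proportion ?L (\<lambda>hs. \<exists>s\<in>nonempty_subset_sums hs. B (x + s))"
    by (simp add: avg_add)
  finally show ?case using Suc by simp
qed

lemma differences_cong_0_if_votes_agree:
  assumes votes: "\<And>s. s \<in> subset_sums hs \<Longrightarrow> [g (x + s) = vote as f (x + s)] (mod q)"
    and vanish: "\<And>s. s \<in> nonempty_subset_sums as \<Longrightarrow> [differences hs f (x + s) = 0] (mod q)"
  shows "[differences hs g x = 0] (mod q)"
proof -
  have "[differences hs g x = differences hs (vote as f) x] (mod q)"
    by (rule cong_differences) (rule votes)
  also have "differences hs (vote as f) x = vote as (differences hs f) x"
    by (simp only: differences_vote)
  also have "[\<dots> = 0] (mod q)"
    by (rule vote_cong_0) (rule vanish)
  finally show ?thesis .
qed

lemma proportion_votes_disagree_le: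
  assumes "plurality q k f g"
  shows "proportion (nlists k X) (\<lambda>as. \<exists>s\<in>subset_sums hs. [g (x + s) \<noteq> vote as f (x + s)] (mod q))
    \<le> 2 ^ length hs * (k * nonvanishing_prob q k f)"
proof -
  let ?L = "nlists k X"
  have "proportion ?L (\<lambda>as. \<exists>s\<in>subset_sums hs. [g (x + s) \<noteq> vote as f (x + s)] (mod q))
      \<le> (\<Sum>s\<in>subset_sums hs. proportion ?L (\<lambda>as. [g (x + s) \<noteq> vote as f (x + s)] (mod q)))"
    by (rule proportion_bex_le_sum) simp
  also have "\<dots> \<le> (\<Sum>s\<in>subset_sums hs. k * nonvanishing_prob q k f)"
    using assms unfolding plurality_def by (intro sum_mono) blast
  also have "\<dots> \<le> 2 ^ length hs * (k * nonvanishing_prob q k f)"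
    using card_subset_sums[of hs]
    by (simp add: mult_right_mono nonvanishing_prob_nonneg flip: of_nat_le_iff)
  finally show ?thesis .
qed

lemma vanishing_differences_if_plurality:
  assumes per: "periodic_mod q f" and plur: "plurality q k f g"
    and small: "nonvanishing_prob q k f < robustness k"
  shows "vanishing_differences q k g"
  unfolding vanishing_differences_def
proof (intro allI impI, rule ccontr)
  fix hs :: "'a list" and x
  assume len: "length hs = k" and nonzero: "[differences hs g x \<noteq> 0] (mod q)"
  let ?L = "nlists k X" and ?\<epsilon> = "nonvanishing_prob q k f"
  let ?disagree = "\<lambda>as. \<exists>s\<in>subset_sums hs. [g (x + s) \<noteq> vote as f (x + s)] (mod q)"
  let ?nonvanishing = "\<lambda>as. \<exists>s\<in>nonempty_subset_sums as. [differences hs f (x + s) \<noteq> 0] (mod q)"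
  have "1 = proportion ?L (\<lambda>_. True)" by simp
  also have "\<dots> \<le> proportion ?L ?disagree + proportion ?L ?nonvanishing"
  proof (rule proportion_le_add, rule ccontr)
    fix as assume neither: "\<not> (?disagree as \<or> ?nonvanishing as)"
    have "[differences hs g x = 0] (mod q)"
      by (rule differences_cong_0_if_votes_agree[where as = as and f = f]) (use neither in simp_all)
    with nonzero show False by contradiction
  qed
  also have "proportion ?L ?disagree \<le> 2 ^ k * (k * ?\<epsilon>)"
    using proportion_votes_disagree_le[OF plur, of hs x] len by simp
  also have "proportion ?L ?nonvanishing
      \<le> 2 ^ k * proportion X (\<lambda>y. [differences hs f y \<noteq> 0] (mod q))"
    using periodic_cong_0[OF periodic_mod_differences[OF per]]
    by (intro proportion_hits_nonempty_subset_sums) (simp add: periodic_def)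
  also have "proportion X (\<lambda>y. [differences hs f y \<noteq> 0] (mod q)) \<le> 2 ^ k * ?\<epsilon>"
    using nonvanishing_fixed_directions[OF per, of hs] len by simp
  finally show False using small unfolding less_robustness_iff by (simp add: algebra_simps)
qed

lemma dist_mod_plurality_le:
  assumes plur: "plurality q k f g" and half: "k * nonvanishing_prob q k f \<le> 1 / 2"
  shows "dist_mod q f g \<le> 2 * nonvanishing_prob q k f"
proof -
  have "1 / 2 * of_bool ([f x \<noteq> g x] (mod q)) \<le> nonvanishing_at q k f x" for x
  proof (cases "[f x = g x] (mod q)")
    case False
    have "1 = proportion (nlists k X) (\<lambda>_. True)" by simp
    also have "\<dots> \<le> proportion (nlists k X) (\<lambda>hs. [g x \<noteq> vote hs f x] (mod q))
        + nonvanishing_at q k f x"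
      unfolding nonvanishing_at_def
    proof (rule proportion_le_add)
      fix hs :: "'a list"
      have "[vote hs f x = f x - (-1) ^ length hs * 0] (mod q)"
        if "[differences hs f x = 0] (mod q)"
        unfolding vote_def using that by (intro cong_diff cong_scalar_left cong_refl)
      then show "[g x \<noteq> vote hs f x] (mod q) \<or> [differences hs f x \<noteq> 0] (mod q)"
        using False by (auto simp: cong_def)
    qed
    also have "proportion (nlists k X) (\<lambda>hs. [g x \<noteq> vote hs f x] (mod q)) \<le> 1 / 2"
      using plur half unfolding plurality_def by (meson order_trans)
    finally show ?thesis using False by simp
  qed (auto simp: nonvanishing_at_def intro: avg_nonneg)
  then have "1 / 2 * dist_mod q f g \<le> nonvanishing_prob q k f"
    unfolding dist_mod_def nonvanishing_prob_def avg_cmult[symmetric] by (intro avg_mono)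
  then show ?thesis by simp
qed

theorem self_correction:
  assumes per: "periodic_mod q f" and small: "nonvanishing_prob q (Suc d) f < robustness (Suc d)"
  shows "\<exists>g. low_degree q d g \<and> dist_mod q f g \<le> 2 * nonvanishing_prob q (Suc d) f"
proof -
  let ?k = "Suc d" and ?\<epsilon> = "nonvanishing_prob q (Suc d) f"
  have "2 * (?k * ?\<epsilon>) \<le> 2 ^ ?k * ((real ?k + 2 ^ ?k) * ?\<epsilon>)"
    using nonvanishing_prob_nonneg by (intro mult_mono mult_right_mono) auto
  also have "\<dots> \<le> 1"
    using small unfolding less_robustness_iff by (rule less_imp_le)
  finally have half: "?k * ?\<epsilon> \<le> 1 / 2" by simp
  obtain g where "periodic_mod q g" "plurality q ?k f g"
    using ex_plurality[OF per] by blast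
  then show ?thesis
    using vanishing_differences_if_plurality[OF per _ small] dist_mod_plurality_le[OF _ half]
    unfolding low_degree_def by blast
qed

lemma proportion_differences_le_dist_mod:
  assumes f: "periodic_mod q f" and g: "low_degree q d g" and hs: "length hs = Suc d"
  shows "proportion X (\<lambda>x. [differences hs f x \<noteq> 0] (mod q)) \<le> 2 ^ Suc d * dist_mod q f g"
proof -
  have "proportion X (\<lambda>x. [differences hs f x \<noteq> 0] (mod q))
      \<le> proportion X (\<lambda>x. \<exists>s\<in>subset_sums hs. [f (x + (0 + s)) \<noteq> g (x + (0 + s))] (mod q))"
  proof (rule proportion_mono, rule ccontr)
    fix x
    assume nonzero: "[differences hs f x \<noteq> 0] (mod q)"
      and "\<not> (\<exists>s\<in>subset_sums hs. [f (x + (0 + s)) \<noteq> g (x + (0 + s))] (mod q))"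
    then have "[differences hs f x = differences hs g x] (mod q)"
      by (intro cong_differences) simp
    also have "[differences hs g x = 0] (mod q)"
      using g hs by (simp add: low_degree_def vanishing_differences_def)
    finally show False using nonzero by contradiction
  qed
  also have "\<dots> \<le> 2 ^ length hs * proportion X (\<lambda>x. [f x \<noteq> g x] (mod q))"
    using periodic_cong_0[OF periodic_mod_diff[of q f g]] f g
    by (intro proportion_hits_subset_sums)
      (simp add: low_degree_def periodic_def cong_diff_iff_cong_0)
  finally show ?thesis by (simp add: hs dist_mod_def)
qed

lemma cong_if_low_degree_0:
  assumes "low_degree q 0 g"
  shows "[g x = g y] (mod q)"
proof -
  have "[differences [x - y] g y = 0] (mod q)"
    using assms unfolding low_degree_def vanishing_differences_def
    by (metis length_Cons list.size(3))
  then show ?thesis by (simp add: difference_def cong_diff_iff_cong_0)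
qed

lemma low_degree_difference: "low_degree q (Suc d) g \<Longrightarrow> low_degree q d (difference h g)"
  unfolding low_degree_def vanishing_differences_Suc[of q "Suc d"]
  by (simp add: periodic_mod_difference)

lemma nonzero_density:
  assumes "low_degree q d g" "[g x \<noteq> 0] (mod q)"
  shows "1 / 2 ^ d \<le> proportion X (\<lambda>x. [g x \<noteq> 0] (mod q))"
  using assms
proof (induction d arbitrary: g x)
  case 0
  then have "[g y \<noteq> 0] (mod q)" for y
    using cong_if_low_degree_0[of q g x y] by (simp add: cong_def)
  then show ?case by simp
next
  case (Suc d)
  show ?case
  proof (cases "\<exists>h y. [difference h g y \<noteq> 0] (mod q)")
    case True
    then obtain h y where "[difference h g y \<noteq> 0] (mod q)" by blast
    then have "1 / 2 ^ d \<le> proportion X (\<lambda>x. [difference h g x \<noteq> 0] (mod q))"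
      using Suc by (intro Suc.IH low_degree_difference)
    also have "\<dots> \<le> proportion X (\<lambda>x. [g (x + h) \<noteq> 0] (mod q))
        + proportion X (\<lambda>x. [g x \<noteq> 0] (mod q))"
      by (rule proportion_le_add) (auto simp: difference_def cong_0_iff)
    also have "proportion X (\<lambda>x. [g (x + h) \<noteq> 0] (mod q)) = proportion X (\<lambda>x. [g x \<noteq> 0] (mod q))"
      using Suc.prems(1) periodic_cong_0[of q g] unfolding low_degree_def
      by (intro proportion_shift) (simp add: periodic_def)
    finally show ?thesis by (simp add: field_simps)
  next
    case False
    then have "low_degree q 0 g"
      using Suc.prems(1) unfolding low_degree_def
      by (simp add: vanishing_differences_Suc vanishing_differences_0)
    then have "[g y \<noteq> 0] (mod q)" for y
      using cong_if_low_degree_0[of q g x y] Suc.prems(2) by (simp add: cong_def)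
    moreover have "1 / 2 ^ Suc d \<le> (1::real)" using one_le_power[of "2::real" "Suc d"] by simp
    ultimately show ?thesis by simp
  qed
qed

end

section \<open>Polynomial functions over a prime field\<close>

definition mod_vec :: "nat \<Rightarrow> nat \<Rightarrow> (nat \<Rightarrow> int) \<Rightarrow> nat \<Rightarrow> int" where
  "mod_vec p n x = (\<lambda>i. if i < n then x i mod int p else 0)"

definition vecs :: "nat \<Rightarrow> nat \<Rightarrow> (nat \<Rightarrow> int) set" where
  "vecs p n = {x. (\<forall>i<n. 0 \<le> x i \<and> x i < int p) \<and> (\<forall>i\<ge>n. x i = 0)}"

definition unit_vec :: "nat \<Rightarrow> nat \<Rightarrow> int" where
  "unit_vec l = (\<lambda>i. if i = l then 1 else 0)"

definition to_point :: "nat \<Rightarrow> nat \<Rightarrow> (nat \<Rightarrow> int) \<Rightarrow> nat list" where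
  "to_point p n x = map (\<lambda>i. nat (x i mod int p)) [0..<n]"

definition of_point :: "nat list \<Rightarrow> nat \<Rightarrow> int" where
  "of_point xs = (\<lambda>i. if i < length xs then int (xs ! i) else 0)"

definition lift :: "nat \<Rightarrow> nat \<Rightarrow> (nat list \<Rightarrow> nat) \<Rightarrow> (nat \<Rightarrow> int) \<Rightarrow> int" where
  "lift p n f x = int (f (to_point p n x))"

definition exponents :: "nat \<Rightarrow> nat \<Rightarrow> nat \<Rightarrow> nat list set" where
  "exponents p n d = {e \<in> Fpn p n. sum_list e \<le> d}"

definition poly_fun :: "nat \<Rightarrow> nat \<Rightarrow> nat \<Rightarrow> (nat list \<Rightarrow> int) \<Rightarrow> (nat \<Rightarrow> int) \<Rightarrow> int" where
  "poly_fun p n d C x = (\<Sum>e\<in>exponents p n d. C e * (\<Prod>i<n. x i ^ (e ! i)))"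

lemma mod_vec_eq_iff: "mod_vec p n v = mod_vec p n w \<longleftrightarrow> (\<forall>i<n. [v i = w i] (mod int p))"
  by (auto simp: mod_vec_def fun_eq_iff cong_def)

lemma to_point_mod_vec [simp]: "to_point p n (mod_vec p n x) = to_point p n x"
  by (simp add: to_point_def mod_vec_def)

lemma Fpn_eq_nlists: "Fpn p n = nlists n {..<p}"
  by (auto simp: Fpn_def nlists_def[symmetric] intro!: nlistsI dest: nlistsE_set)

lemma finite_Fpn [simp]: "finite (Fpn p n)"
  by (simp add: Fpn_eq_nlists)

lemma card_Fpn: "card (Fpn p n) = p ^ n"
  by (simp add: Fpn_eq_nlists card_nlists)

lemma finite_exponents [simp]: "finite (exponents p n d)"
  by (simp add: exponents_def)

lemma vanishing_differences_coordinate: "vanishing_differences q 2 (\<lambda>x :: nat \<Rightarrow> int. x i)"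
  by (simp add: numeral_2_eq_2 vanishing_differences_Suc vanishing_differences_0 difference_def)

lemma vanishing_differences_poly_fun: "vanishing_differences q (Suc d) (poly_fun p n d C)"
proof -
  have "vanishing_differences q (Suc d) (\<lambda>x. C e * (\<Prod>i<n. x i ^ (e ! i)))"
    if "e \<in> exponents p n d" for e
  proof -
    have "(\<Sum>i<n. e ! i) \<le> d"
      using that by (auto simp: exponents_def Fpn_def sum_list_sum_nth atLeast0LessThan)
    moreover have "vanishing_differences q (Suc (\<Sum>i<n. e ! i)) (\<lambda>x. \<Prod>i<n. x i ^ (e ! i))"
      by (intro vanishing_differences_prod vanishing_differences_power
          vanishing_differences_coordinate)
    ultimately have "vanishing_differences q (Suc d) (\<lambda>x. \<Prod>i<n. x i ^ (e ! i))"
      by (meson Suc_le_mono vanishing_differences_mono)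
    then show ?thesis by (rule vanishing_differences_cmult)
  qed
  then show ?thesis
    unfolding poly_fun_def[abs_def] by (rule vanishing_differences_sum)
qed

lemma poly_fun_cong:
  assumes "\<And>e. e \<in> exponents p n d \<Longrightarrow> [C e = C' e] (mod q)" and "\<And>i. i < n \<Longrightarrow> [x i = y i] (mod q)"
  shows "[poly_fun p n d C x = poly_fun p n d C' y] (mod q)"
  unfolding poly_fun_def using assms by (intro cong_sum cong_mult cong_prod cong_pow) auto

lemma sum_cmult_poly_fun:
  "(\<Sum>j\<in>J. c j * poly_fun p n d (C j) x) = poly_fun p n d (\<lambda>e. \<Sum>j\<in>J. c j * C j e) x"
  unfolding poly_fun_def sum_distrib_left sum_distrib_right
  by (subst sum.swap) (simp only: mult.assoc)

lemma prod_poly_eq_poly_fun: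
  assumes j: "j \<in> exponents p n d" and deg: "\<And>i. i < n \<Longrightarrow> degree (Q i) \<le> j ! i"
  shows "(\<Prod>i<n. poly (Q i) (x i)) = poly_fun p n d (\<lambda>e. \<Prod>i<n. coeff (Q i) (e ! i)) x"
proof -
  have len: "length j = n" using j by (simp add: exponents_def Fpn_def)
  have "poly (Q i) (x i) = (\<Sum>l<p. coeff (Q i) l * x i ^ l)" if "i < n" for i
  proof -
    have "j ! i < p" using j len that by (simp add: exponents_def Fpn_def)
    then show ?thesis
      using deg[OF that] unfolding poly_altdef
      by (intro sum.mono_neutral_left) (auto simp: coeff_eq_0)
  qed
  then have "(\<Prod>i<n. poly (Q i) (x i)) = (\<Prod>i<n. \<Sum>l<p. coeff (Q i) l * x i ^ l)" by simp
  also have "\<dots> = (\<Sum>e\<in>Fpn p n. (\<Prod>i<n. coeff (Q i) (e ! i)) * (\<Prod>i<n. x i ^ (e ! i)))"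
    unfolding prod_sum_nlists Fpn_eq_nlists by (simp add: prod.distrib)
  also have "\<dots> = poly_fun p n d (\<lambda>e. \<Prod>i<n. coeff (Q i) (e ! i)) x"
    unfolding poly_fun_def
  proof (intro sum.mono_neutral_right ballI)
    fix e assume e: "e \<in> Fpn p n - exponents p n d"
    then have "(\<Sum>i<n. j ! i) < (\<Sum>i<n. e ! i)"
      using j len by (auto simp: exponents_def Fpn_def sum_list_sum_nth atLeast0LessThan)
    then obtain i where i: "i < n" "j ! i < e ! i"
      by (meson lessThan_iff not_le sum_mono)
    then have "coeff (Q i) (e ! i) = 0" using deg[of i] by (intro coeff_eq_0) simp
    with i(1) show "(\<Prod>i<n. coeff (Q i) (e ! i)) * (\<Prod>i<n. x i ^ (e ! i)) = 0" by auto
  qed (auto simp: exponents_def)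
  finally show ?thesis .
qed

locale prime_modulus =
  fixes p :: nat
  assumes prime_p: "prime p"
begin

lemma p_pos [simp]: "p > 0"
  using prime_p by (rule prime_gt_0_nat)

lemma p_ge_2: "p \<ge> 2"
  using prime_p by (rule prime_ge_2_nat)

lemma to_point_in [simp]: "to_point p n x \<in> Fpn p n"
  by (auto simp: Fpn_def to_point_def nat_less_iff)

lemma of_point_in: "xs \<in> Fpn p n \<Longrightarrow> of_point xs \<in> vecs p n"
  by (auto simp: Fpn_def of_point_def vecs_def)

lemma of_point_to_point: "x \<in> vecs p n \<Longrightarrow> of_point (to_point p n x) = x"
  by (auto simp: vecs_def of_point_def to_point_def fun_eq_iff)

lemma to_point_of_point: "xs \<in> Fpn p n \<Longrightarrow> to_point p n (of_point xs) = xs"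
  by (auto simp: Fpn_def of_point_def to_point_def intro!: nth_equalityI)

lemma ball_Fpn_iff: "(\<forall>y\<in>Fpn p n. P y) \<longleftrightarrow> (\<forall>x. P (to_point p n x))"
  by (metis to_point_in to_point_of_point)

lemma bij_to_point: "bij_betw (to_point p n) (vecs p n) (Fpn p n)"
  by (rule bij_betw_byWitness[where f' = of_point])
    (auto simp: of_point_to_point to_point_of_point of_point_in)

lemma finite_vecs [simp]: "finite (vecs p n)"
  using bij_betw_finite[OF bij_to_point[of n]] by simp

lemma card_vecs: "card (vecs p n) = p ^ n"
  using bij_betw_same_card[OF bij_to_point[of n]] by (simp add: card_Fpn)

lemma to_point_eq_iff: "to_point p n v = to_point p n w \<longleftrightarrow> mod_vec p n v = mod_vec p n w"
  by (auto simp: to_point_def mod_vec_def fun_eq_iff eq_nat_nat_iff)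

sublocale vec: reduction "vecs p n" "mod_vec p n" for n
proof
  show "mod_vec p n a \<in> vecs p n" for a by (auto simp: mod_vec_def vecs_def)
  show "mod_vec p n x = x" if "x \<in> vecs p n" for x
    using that by (auto simp: mod_vec_def vecs_def fun_eq_iff)
  show "mod_vec p n (mod_vec p n a + b) = mod_vec p n (a + b)" for a b
    by (auto simp: mod_vec_def fun_eq_iff mod_add_left_eq)
qed simp

abbreviation low_degree :: "nat \<Rightarrow> nat \<Rightarrow> ((nat \<Rightarrow> int) \<Rightarrow> int) \<Rightarrow> bool" where
  "low_degree n \<equiv> vec.low_degree n (int p)"

abbreviation dist_mod :: "nat \<Rightarrow> ((nat \<Rightarrow> int) \<Rightarrow> int) \<Rightarrow> ((nat \<Rightarrow> int) \<Rightarrow> int) \<Rightarrow> real" where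
  "dist_mod n \<equiv> vec.dist_mod n (int p)"

lemma periodic_mod_lift: "vec.periodic_mod n q (lift p n f)"
  by (simp add: vec.periodic_mod_def lift_def)

lemma low_degree_poly_fun: "low_degree n d (poly_fun p n d C)"
  unfolding vec.low_degree_def vec.periodic_mod_def
  by (intro conjI allI vanishing_differences_poly_fun poly_fun_cong) (simp_all add: mod_vec_def)

lemma binomial_cong_poly:
  assumes "j < p"
  shows "\<exists>P :: int poly. degree P \<le> j \<and> (\<forall>a. [int (a choose j) = poly P (int a)] (mod int p))"
proof -
  have "coprime p (fact j)"
    using assms prime_p by (intro prime_imp_coprime) (simp_all add: prime_dvd_fact_iff)
  then have "coprime (int (fact j)) (int p)" by (simp only: coprime_int_iff coprime_commute)
  then obtain c where c: "[int (fact j) * c = 1] (mod int p)"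
    using coprime_iff_invertible_int by blast
  define Q where "Q = (\<Prod>i<j. [:- int i, 1:])"
  have Q: "poly Q (int a) = int (fact j) * int (a choose j)" for a
  proof -
    have "of_int (poly Q (int a)) = (of_int (int (fact j) * int (a choose j)) :: rat)"
      by (simp add: Q_def poly_prod gbinomial_mult_fact binomial_gbinomial atLeast0LessThan)
    then show ?thesis by (simp only: of_int_eq_iff)
  qed
  show ?thesis
  proof (intro exI[of _ "smult c Q"] conjI allI)
    have "degree Q \<le> (\<Sum>i<j. degree [:- int i, 1:])"
      unfolding Q_def using degree_prod_sum_le[of "{..<j}" "\<lambda>i. [:- int i, 1:]"]
      by (simp add: o_def)
    then show "degree (smult c Q) \<le> j"
      using degree_smult_le[of c Q] by simp
    fix a
    have "[1 * int (a choose j) = int (fact j) * c * int (a choose j)] (mod int p)"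
      using c by (intro cong_scalar_right) (rule cong_sym)
    then show "[int (a choose j) = poly (smult c Q) (int a)] (mod int p)"
      by (simp add: Q mult_ac)
  qed
qed

definition coordinate_directions :: "nat list \<Rightarrow> (nat \<Rightarrow> int) list" where
  "coordinate_directions j = concat (map (\<lambda>i. replicate (j ! i) (unit_vec i)) [0..<length j])"

lemma length_coordinate_directions: "length (coordinate_directions j) = sum_list j"
  by (simp add: coordinate_directions_def length_concat o_def map_nth)

lemma coordinate_directions_snoc:
  "coordinate_directions (j @ [k]) = coordinate_directions j @ replicate k (unit_vec (length j))"
proof -
  have "map (\<lambda>i. replicate ((j @ [k]) ! i) (unit_vec i)) [0..<length j]
      = map (\<lambda>i. replicate (j ! i) (unit_vec i)) [0..<length j]"
    by (rule map_cong) (simp_all add: nth_append)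
  then show ?thesis by (simp add: coordinate_directions_def del: map_eq_conv)
qed

lemma newton_expansion_coordinates:
  assumes "x \<in> vecs p n"
  shows "g x = (\<Sum>j\<in>Fpn p n.
    (\<Prod>i<n. int (nat (x i) choose (j ! i))) * differences (coordinate_directions j) g 0)"
  using assms
proof (induction n arbitrary: x g)
  case 0
  then have "x = 0" by (auto simp: vecs_def)
  then show ?case by (simp add: Fpn_eq_nlists coordinate_directions_def)
next
  case (Suc n)
  define a where "a = nat (x n)"
  define x' where "x' = x(n := 0)"
  have x': "x' \<in> vecs p n" using Suc.prems by (auto simp: vecs_def x'_def)
  have "int a = x n" using Suc.prems by (simp add: a_def vecs_def)
  then have a: "a < p" "x = x' + of_nat a * unit_vec n"
    using Suc.prems by (auto simp: vecs_def x'_def unit_vec_def fun_eq_iff nat_less_iff)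
  let ?D = "\<lambda>k. differences (replicate k (unit_vec n)) g"
  let ?B = "\<lambda>m y j. \<Prod>i<m. int (nat (y i) choose (j ! i))"
  have snoc: "?B (Suc n) x (j @ [k]) * differences (coordinate_directions (j @ [k])) g 0
      = int (a choose k) * (?B n x' j * differences (coordinate_directions j) (?D k) 0)"
    if "j \<in> nlists n {..<p}" for j k
  proof -
    have len: "length j = n" using that by simp
    have "?B n x (j @ [k]) = ?B n x' j"
      by (intro prod.cong) (auto simp: nth_append len x'_def)
    then show ?thesis
      by (simp add: len coordinate_directions_snoc differences_append nth_append a_def mult_ac)
  qed
  have "g x = (\<Sum>k\<le>a. int (a choose k) * ?D k x')"
    unfolding a(2) by (rule newton_expansion)
  also have "\<dots> = (\<Sum>k<p. int (a choose k) * ?D k x')"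
    using a(1) by (intro sum.mono_neutral_left) (auto simp: binomial_eq_0)
  also have "\<dots> = (\<Sum>k<p. \<Sum>j\<in>nlists n {..<p}.
      int (a choose k) * (?B n x' j * differences (coordinate_directions j) (?D k) 0))"
    by (simp only: Suc.IH[OF x', of "?D _"] sum_distrib_left Fpn_eq_nlists)
  also have "\<dots> = (\<Sum>j\<in>Fpn p (Suc n). ?B (Suc n) x j * differences (coordinate_directions j) g 0)"
    unfolding Fpn_eq_nlists sum_nlists_snoc
    by (subst sum.swap) (intro sum.cong refl snoc[symmetric])
  finally show ?case .
qed

lemma low_degree_newton_expansion:
  assumes g: "low_degree n d g" and x: "x \<in> vecs p n"
  shows "[g x = (\<Sum>j\<in>exponents p n d. differences (coordinate_directions j) g 0 *
    (\<Prod>i<n. int (nat (x i) choose (j ! i))))] (mod int p)"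
proof -
  let ?c = "\<lambda>j. differences (coordinate_directions j) g 0"
  let ?B = "\<lambda>j. \<Prod>i<n. int (nat (x i) choose (j ! i))"
  have high_order: "[?c j = 0] (mod int p)" if "\<not> sum_list j \<le> d" for j
  proof -
    have "vanishing_differences (int p) (sum_list j) g"
      using g that unfolding vec.low_degree_def by (auto intro: vanishing_differences_mono)
    then show ?thesis
      by (simp add: vanishing_differences_def length_coordinate_directions)
  qed
  have "g x = (\<Sum>j\<in>Fpn p n. ?B j * ?c j)"
    using x by (rule newton_expansion_coordinates)
  also have "[\<dots> = (\<Sum>j\<in>Fpn p n. if sum_list j \<le> d then ?c j * ?B j else 0)] (mod int p)"
    using high_order by (intro cong_sum) (auto simp: cong_0_iff mult.commute)
  also have "(\<Sum>j\<in>Fpn p n. if sum_list j \<le> d then ?c j * ?B j else 0)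
      = (\<Sum>j\<in>exponents p n d. ?c j * ?B j)"
    unfolding exponents_def by (simp add: sum.inter_filter)
  finally show ?thesis .
qed

lemma low_degree_imp_poly_fun_on_vecs:
  assumes "low_degree n d g"
  shows "\<exists>C. \<forall>x\<in>vecs p n. [g x = poly_fun p n d C x] (mod int p)"
proof -
  obtain P :: "nat \<Rightarrow> int poly" where deg: "\<And>j. j < p \<Longrightarrow> degree (P j) \<le> j"
    and P: "\<And>j a. j < p \<Longrightarrow> [int (a choose j) = poly (P j) (int a)] (mod int p)"
    using binomial_cong_poly by metis
  have nth_less: "j ! i < p" if "j \<in> exponents p n d" "i < n" for i j
    using that by (simp add: exponents_def Fpn_def)
  let ?c = "\<lambda>j. differences (coordinate_directions j) g 0"
  let ?C = "\<lambda>e. \<Sum>j\<in>exponents p n d. ?c j * (\<Prod>i<n. coeff (P (j ! i)) (e ! i))"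
  have "[g x = poly_fun p n d ?C x] (mod int p)" if x: "x \<in> vecs p n" for x
  proof -
    let ?newton = "\<Sum>j\<in>exponents p n d. ?c j * (\<Prod>i<n. int (nat (x i) choose (j ! i)))"
    have "[g x = ?newton] (mod int p)"
      using assms x by (rule low_degree_newton_expansion)
    also have "[?newton = (\<Sum>j\<in>exponents p n d. ?c j * (\<Prod>i<n. poly (P (j ! i)) (x i)))] (mod int p)"
    proof (intro cong_sum cong_scalar_left cong_prod)
      fix j i assume "j \<in> exponents p n d" "i \<in> {..<n}"
      then show "[int (nat (x i) choose (j ! i)) = poly (P (j ! i)) (x i)] (mod int p)"
        using P[of "j ! i" "nat (x i)"] nth_less x by (simp add: vecs_def)
    qed
    also have "(\<Sum>j\<in>exponents p n d. ?c j * (\<Prod>i<n. poly (P (j ! i)) (x i)))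
        = (\<Sum>j\<in>exponents p n d. ?c j * poly_fun p n d (\<lambda>e. \<Prod>i<n. coeff (P (j ! i)) (e ! i)) x)"
      using nth_less deg
      by (intro sum.cong refl arg_cong2[where f = "(*)"] prod_poly_eq_poly_fun) auto
    also have "\<dots> = poly_fun p n d ?C x"
      by (rule sum_cmult_poly_fun)
    finally show ?thesis .
  qed
  then show ?thesis by blast
qed

lemma low_degree_imp_poly_fun:
  assumes "low_degree n d g"
  shows "\<exists>C \<in> exponents p n d \<rightarrow>\<^sub>E {0..<int p}. \<forall>x. [g x = poly_fun p n d C x] (mod int p)"
proof -
  obtain C where C: "\<forall>x\<in>vecs p n. [g x = poly_fun p n d C x] (mod int p)"
    using low_degree_imp_poly_fun_on_vecs[OF assms] by blast
  define C' where "C' = restrict (\<lambda>e. C e mod int p) (exponents p n d)"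
  have "[g x = poly_fun p n d C' x] (mod int p)" for x
  proof -
    have "[g x = g (mod_vec p n x)] (mod int p)"
      using assms by (simp add: vec.low_degree_def vec.periodic_mod_def cong_sym)
    also have "[g (mod_vec p n x) = poly_fun p n d C (mod_vec p n x)] (mod int p)"
      using C by simp
    also have "[poly_fun p n d C (mod_vec p n x) = poly_fun p n d C' x] (mod int p)"
      by (intro poly_fun_cong) (simp_all add: C'_def mod_vec_def)
    finally show ?thesis .
  qed
  moreover have "C' \<in> exponents p n d \<rightarrow>\<^sub>E {0..<int p}" by (simp add: C'_def)
  ultimately show ?thesis by blast
qed

lemma eval_cong_poly_fun:
  "[int (\<Sum>e\<in>Fpn p n. if sum_list e \<le> d then C e * mono_eval (to_point p n x) e else 0)
    = poly_fun p n d (\<lambda>e. int (C e)) x] (mod int p)"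
proof -
  have "[int (C e * mono_eval (to_point p n x) e) = int (C e) * (\<Prod>i<n. x i ^ (e ! i))]
      (mod int p)" for e
    by (auto simp: mono_eval_def to_point_def intro!: cong_scalar_left cong_prod cong_pow)
  then have "[(\<Sum>e\<in>exponents p n d. int (C e * mono_eval (to_point p n x) e))
      = poly_fun p n d (\<lambda>e. int (C e)) x] (mod int p)"
    unfolding poly_fun_def by (rule cong_sum)
  then show ?thesis
    by (simp add: exponents_def sum.inter_filter if_distrib[of int] cong: if_cong)
qed

lemma deg_le_iff_cong_poly_fun:
  assumes "is_fn p n f"
  shows "deg_le p n d f \<longleftrightarrow> (\<exists>C. \<forall>x. [lift p n f x = poly_fun p n d (\<lambda>e. int (C e)) x] (mod int p))"
proof -
  let ?S = "\<lambda>C y. \<Sum>e\<in>Fpn p n. if sum_list e \<le> d then C e * mono_eval y e else 0"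
  have "f y = ?S C y mod p \<longleftrightarrow> [int (f y) = int (?S C y)] (mod int p)" if "y \<in> Fpn p n" for C y
    using assms that unfolding cong_int_iff by (simp add: is_fn_def cong_def)
  then have "deg_le p n d f \<longleftrightarrow> (\<exists>C. \<forall>y\<in>Fpn p n. [int (f y) = int (?S C y)] (mod int p))"
    by (simp add: deg_le_def)
  also have "\<dots> \<longleftrightarrow> (\<exists>C. \<forall>x. [int (f (to_point p n x)) = int (?S C (to_point p n x))] (mod int p))"
    by (simp only: ball_Fpn_iff)
  also have "\<dots> \<longleftrightarrow> (\<exists>C. \<forall>x. [lift p n f x = poly_fun p n d (\<lambda>e. int (C e)) x] (mod int p))"
    using eval_cong_poly_fun[where n = n and d = d] by (simp add: lift_def cong_def)
  finally show ?thesis .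
qed

lemma deg_le_iff_low_degree:
  assumes "is_fn p n f"
  shows "deg_le p n d f \<longleftrightarrow> low_degree n d (lift p n f)"
proof
  assume "deg_le p n d f"
  then obtain C where C: "\<And>x. [lift p n f x = poly_fun p n d (\<lambda>e. int (C e)) x] (mod int p)"
    using deg_le_iff_cong_poly_fun[OF assms] by blast
  show "low_degree n d (lift p n f)"
    using low_degree_poly_fun by (subst vec.low_degree_cong[OF C])
next
  assume "low_degree n d (lift p n f)"
  from low_degree_imp_poly_fun[OF this] obtain C where C: "C \<in> exponents p n d \<rightarrow>\<^sub>E {0..<int p}"
    "\<And>x. [lift p n f x = poly_fun p n d C x] (mod int p)" by blast
  have "[poly_fun p n d C x = poly_fun p n d (\<lambda>e. int (nat (C e))) x] (mod int p)" for x
    using C(1) by (intro poly_fun_cong cong_refl) (auto simp: PiE_def Pi_def)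
  then have "[lift p n f x = poly_fun p n d (\<lambda>e. int (nat (C e))) x] (mod int p)" for x
    by (rule cong_trans[OF C(2)])
  then show "deg_le p n d f"
    unfolding deg_le_iff_cong_poly_fun[OF assms] by (intro exI[of _ "\<lambda>e. nat (C e)"] allI)
qed

lemma rel_dist_eq_dist_mod:
  assumes "is_fn p n f" "is_fn p n g"
  shows "rel_dist p n f g = dist_mod n (lift p n f) (lift p n g)"
proof -
  have "f (to_point p n v) \<noteq> g (to_point p n v) \<longleftrightarrow> [lift p n f v \<noteq> lift p n g v] (mod int p)" for v
    using assms by (simp add: is_fn_def lift_def cong_int_iff cong_def)
  then have "proportion (vecs p n) (\<lambda>v. f (to_point p n v) \<noteq> g (to_point p n v))
      = dist_mod n (lift p n f) (lift p n g)"
    by (simp add: vec.dist_mod_def)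
  moreover have "rel_dist p n f g = proportion (Fpn p n) (\<lambda>x. f x \<noteq> g x)"
    by (simp add: rel_dist_def proportion_eq_card)
  ultimately show ?thesis by (simp add: avg_reindex[OF bij_to_point])
qed

lemma dist_mod_low_degree_ge:
  assumes f: "is_fn p n f" "far_from_deg p n d \<delta> f" and g: "low_degree n d g"
  shows "\<delta> \<le> dist_mod n (lift p n f) g"
proof -
  define g' where "g' xs = nat (g (of_point xs) mod int p)" for xs
  have fn: "is_fn p n g'" by (simp add: is_fn_def g'_def nat_less_iff)
  have cong: "[lift p n g' x = g x] (mod int p)" for x
  proof -
    have "of_point (to_point p n x) = mod_vec p n x"
      using of_point_to_point[of "mod_vec p n x" n] by simp
    then have "[lift p n g' x = g (mod_vec p n x)] (mod int p)" by (simp add: lift_def g'_def)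
    also have "[g (mod_vec p n x) = g x] (mod int p)"
      using g by (simp add: vec.low_degree_def vec.periodic_mod_def)
    finally show ?thesis .
  qed
  have "deg_le p n d g'"
    using g vec.low_degree_cong[OF cong] by (simp add: deg_le_iff_low_degree[OF fn])
  then have "\<delta> \<le> dist_mod n (lift p n f) (lift p n g')"
    using f fn by (simp add: far_from_deg_def flip: rel_dist_eq_dist_mod)
  also have "\<dots> = dist_mod n (lift p n f) g"
    using cong by (simp add: vec.dist_mod_def cong_def)
  finally show ?thesis .
qed

lemma nonvanishing_prob_ge_if_far:
  assumes f: "is_fn p n f" "far_from_deg p n d \<delta> f" and \<delta>: "0 < \<delta>" "\<delta> \<le> 1"
  shows "robustness (Suc d) * \<delta> \<le> vec.nonvanishing_prob n (int p) (Suc d) (lift p n f)"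
    (is "_ \<le> ?\<epsilon>")
proof (cases "?\<epsilon> < robustness (Suc d)")
  case True
  from vec.self_correction[OF periodic_mod_lift this] obtain g
    where "low_degree n d g" "dist_mod n (lift p n f) g \<le> 2 * ?\<epsilon>" by blast
  with dist_mod_low_degree_ge[OF f] have "\<delta> / 2 \<le> ?\<epsilon>" by fastforce
  moreover have "robustness (Suc d) * \<delta> \<le> 1 / 2 * \<delta>"
    using robustness_le_half \<delta> by (intro mult_right_mono) auto
  ultimately show ?thesis by simp
next
  case False
  moreover have "robustness (Suc d) * \<delta> \<le> robustness (Suc d)"
    using robustness_pos[of "Suc d"] \<delta> by (simp add: mult_left_le)
  ultimately show ?thesis by simp
qed

end

section \<open>Interpolation from random points\<close>

context prime_modulus begin

definition unisolvent :: "nat \<Rightarrow> nat \<Rightarrow> (nat \<Rightarrow> int) list \<Rightarrow> bool" where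
  "unisolvent r d ys \<longleftrightarrow> (\<forall>g. low_degree r d g \<longrightarrow> (\<forall>y\<in>set ys. [g y = 0] (mod int p)) \<longrightarrow>
     (\<forall>x. [g x = 0] (mod int p)))"

lemma not_unisolvent_imp_poly_fun:
  assumes "\<not> unisolvent r d ys"
  shows "\<exists>C \<in> exponents p r d \<rightarrow>\<^sub>E {0..<int p}. (\<exists>x. [poly_fun p r d C x \<noteq> 0] (mod int p)) \<and>
    (\<forall>y\<in>set ys. [poly_fun p r d C y = 0] (mod int p))"
proof -
  obtain g x where g: "low_degree r d g" "\<forall>y\<in>set ys. [g y = 0] (mod int p)" "[g x \<noteq> 0] (mod int p)"
    using assms unfolding unisolvent_def by blast
  from low_degree_imp_poly_fun[OF g(1)] obtain C where "C \<in> exponents p r d \<rightarrow>\<^sub>E {0..<int p}"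
    "\<forall>x. [g x = poly_fun p r d C x] (mod int p)" by blast
  with g(2,3) show ?thesis by (auto simp: cong_def)
qed

lemma proportion_not_unisolvent_le:
  "proportion (nlists m (vecs p r)) (\<lambda>ys. \<not> unisolvent r d ys)
    \<le> p ^ card (exponents p r d) * (1 - 1 / 2 ^ d) ^ m"
proof -
  let ?C = "exponents p r d \<rightarrow>\<^sub>E {0..<int p}"
  define \<C> where "\<C> = {C \<in> ?C. \<exists>x. [poly_fun p r d C x \<noteq> 0] (mod int p)}"
  have fin: "finite ?C" by (intro finite_PiE) simp_all
  then have fin\<C>: "finite \<C>" by (simp add: \<C>_def)
  have "proportion (nlists m (vecs p r)) (\<lambda>ys. \<not> unisolvent r d ys)
      \<le> proportion (nlists m (vecs p r))
          (\<lambda>ys. \<exists>C\<in>\<C>. \<forall>y\<in>set ys. [poly_fun p r d C y = 0] (mod int p))"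
    using not_unisolvent_imp_poly_fun[of r d] by (intro proportion_mono) (simp add: \<C>_def, blast)
  also have "\<dots> \<le> (\<Sum>C\<in>\<C>. proportion (vecs p r) (\<lambda>y. [poly_fun p r d C y = 0] (mod int p)) ^ m)"
    unfolding proportion_nlists_all[symmetric] by (rule proportion_bex_le_sum[OF fin\<C>])
  also have "\<dots> \<le> (\<Sum>C\<in>\<C>. (1 - 1 / 2 ^ d) ^ m)"
  proof (intro sum_mono power_mono)
    fix C assume "C \<in> \<C>"
    then obtain x where "[poly_fun p r d C x \<noteq> 0] (mod int p)" by (auto simp: \<C>_def)
    from vec.nonzero_density[OF low_degree_poly_fun this]
    show "proportion (vecs p r) (\<lambda>y. [poly_fun p r d C y = 0] (mod int p)) \<le> 1 - 1 / 2 ^ d"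
      by (simp add: proportion_not)
  qed (simp add: avg_nonneg)
  also have "\<dots> \<le> p ^ card (exponents p r d) * (1 - 1 / 2 ^ d) ^ m"
  proof -
    have "card \<C> \<le> card ?C" using fin by (intro card_mono) (auto simp: \<C>_def)
    also have "\<dots> = p ^ card (exponents p r d)" by (simp add: card_PiE)
    finally have "real (card \<C>) \<le> real (p ^ card (exponents p r d))" by (rule of_nat_mono)
    then show ?thesis by (simp add: mult_right_mono)
  qed
  finally show ?thesis .
qed

definition fits :: "nat \<Rightarrow> nat \<Rightarrow> ((nat \<Rightarrow> int) \<Rightarrow> int) \<Rightarrow> (nat \<Rightarrow> int) list \<Rightarrow> bool" where
  "fits r d F ys \<longleftrightarrow> (\<exists>g. low_degree r d g \<and> (\<forall>y\<in>set ys. [F y = g y] (mod int p)))"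

definition misfit_prob :: "nat \<Rightarrow> nat \<Rightarrow> nat \<Rightarrow> ((nat \<Rightarrow> int) \<Rightarrow> int) \<Rightarrow> real" where
  "misfit_prob r d m F = proportion (nlists (Suc m) (vecs p r)) (\<lambda>ys. \<not> fits r d F ys)"

definition sufficient_samples :: "nat \<Rightarrow> nat \<Rightarrow> nat \<Rightarrow> bool" where
  "sufficient_samples r d m \<longleftrightarrow> proportion (nlists m (vecs p r)) (\<lambda>ys. \<not> unisolvent r d ys) \<le> 1 / 2"

lemma not_fits_Cons:
  assumes uni: "unisolvent r d ys" and g: "low_degree r d g" "\<forall>y\<in>set ys. [F y = g y] (mod int p)"
    and y: "[F y \<noteq> g y] (mod int p)"
  shows "\<not> fits r d F (y # ys)"
proof
  assume "fits r d F (y # ys)"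
  then obtain g' where g': "low_degree r d g'" "\<forall>z\<in>set (y # ys). [F z = g' z] (mod int p)"
    by (auto simp: fits_def)
  have "\<forall>z\<in>set ys. [g z - g' z = 0] (mod int p)"
    unfolding cong_diff_iff_cong_0 using g(2) g'(2) by (simp add: cong_def)
  then have "[g y - g' y = 0] (mod int p)"
    using uni vec.low_degree_diff[OF g(1) g'(1)] unfolding unisolvent_def by blast
  then show False
    unfolding cong_diff_iff_cong_0 using g'(2) y by (simp add: cong_def)
qed

lemma proportion_not_fits_Cons_ge:
  assumes uni: "unisolvent r d ys" and far: "\<And>g. low_degree r d g \<Longrightarrow> \<eta> \<le> dist_mod r F g" and "\<eta> \<le> 1"
  shows "\<eta> \<le> proportion (vecs p r) (\<lambda>y. \<not> fits r d F (y # ys))"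
proof (cases "fits r d F ys")
  case True
  then obtain g where g: "low_degree r d g" "\<forall>y\<in>set ys. [F y = g y] (mod int p)"
    by (auto simp: fits_def)
  have "\<eta> \<le> dist_mod r F g" using g(1) by (rule far)
  also have "\<dots> \<le> proportion (vecs p r) (\<lambda>y. \<not> fits r d F (y # ys))"
    unfolding vec.dist_mod_def by (intro proportion_mono not_fits_Cons[OF uni g])
  finally show ?thesis .
next
  case False
  then have "\<not> fits r d F (y # ys)" for y by (auto simp: fits_def)
  with \<open>\<eta> \<le> 1\<close> show ?thesis by simp
qed

lemma misfit_prob_ge:
  assumes m: "sufficient_samples r d m" and far: "\<And>g. low_degree r d g \<Longrightarrow> \<eta> \<le> dist_mod r F g"
    and \<eta>: "0 \<le> \<eta>" "\<eta> \<le> 1"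
  shows "\<eta> / 2 \<le> misfit_prob r d m F"
proof -
  let ?L = "nlists m (vecs p r)"
  have "\<eta> * (1 / 2) \<le> \<eta> * proportion ?L (unisolvent r d)"
    using m \<eta> by (intro mult_left_mono) (simp_all add: sufficient_samples_def proportion_not)
  also have "\<dots> = avg ?L (\<lambda>ys. \<eta> * of_bool (unisolvent r d ys))"
    by (rule avg_cmult[symmetric])
  also have "\<dots> \<le> avg ?L (\<lambda>ys. proportion (vecs p r) (\<lambda>y. \<not> fits r d F (y # ys)))"
  proof (rule avg_mono)
    fix ys
    show "\<eta> * of_bool (unisolvent r d ys) \<le> proportion (vecs p r) (\<lambda>y. \<not> fits r d F (y # ys))"
      using proportion_not_fits_Cons_ge[OF _ far] \<eta>
      by (cases "unisolvent r d ys") (simp_all add: avg_nonneg)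
  qed
  also have "\<dots> = misfit_prob r d m F"
    unfolding misfit_prob_def avg_nlists_Suc by (rule avg_swap)
  finally show ?thesis by simp
qed

lemma proportion_differences_le_misfit_prob:
  assumes m: "sufficient_samples r d m" and F: "vec.periodic_mod r (int p) F"
    and hs: "length hs = Suc d"
  shows "proportion (vecs p r) (\<lambda>a. [differences hs F a \<noteq> 0] (mod int p))
    \<le> 2 ^ (d + 2) * misfit_prob r d m F"
proof -
  let ?\<epsilon> = "proportion (vecs p r) (\<lambda>a. [differences hs F a \<noteq> 0] (mod int p))"
  have "?\<epsilon> / 2 ^ Suc d / 2 \<le> misfit_prob r d m F"
  proof (rule misfit_prob_ge[OF m])
    show "?\<epsilon> / 2 ^ Suc d \<le> dist_mod r F g" if "low_degree r d g" for g
      using vec.proportion_differences_le_dist_mod[OF F that hs]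
      by (simp add: divide_le_eq mult.commute)
    show "?\<epsilon> / 2 ^ Suc d \<le> 1"
      using proportion_le_1[of "vecs p r" "\<lambda>a. [differences hs F a \<noteq> 0] (mod int p)"]
        one_le_power[of "2::real" "Suc d"]
      by (simp add: divide_le_eq)
  qed (simp add: avg_nonneg)
  then show ?thesis by (simp add: field_simps)
qed

end

section \<open>Random affine maps\<close>

definition lin_comb :: "(nat \<Rightarrow> int) \<Rightarrow> (nat \<Rightarrow> int) list \<Rightarrow> nat \<Rightarrow> int" where
  "lin_comb y cs = (\<lambda>i. \<Sum>l<length cs. y l * (cs ! l) i)"

abbreviation affine_map :: "(nat \<Rightarrow> int) \<Rightarrow> (nat \<Rightarrow> int) list \<Rightarrow> (nat \<Rightarrow> int) \<Rightarrow> nat \<Rightarrow> int" where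
  "affine_map b cs y \<equiv> b + lin_comb y cs"

lemma lin_comb_add: "lin_comb (x + y) cs = lin_comb x cs + lin_comb y cs"
  by (simp add: lin_comb_def fun_eq_iff algebra_simps sum.distrib)

lemma lin_comb_Cons: "lin_comb y (c # cs) = (\<lambda>i. y 0 * c i) + lin_comb (\<lambda>l. y (Suc l)) cs"
  unfolding lin_comb_def fun_eq_iff length_Cons sum.lessThan_Suc_shift by simp

lemma lin_comb_unit_vec:
  assumes "l < length cs" shows "lin_comb (unit_vec l) cs = cs ! l"
proof -
  have "(\<Sum>j<length cs. unit_vec l j * (cs ! j) i)
      = (\<Sum>j<length cs. if j = l then (cs ! j) i else 0)" for i
    by (intro sum.cong) (auto simp: unit_vec_def)
  then show ?thesis using assms by (simp add: lin_comb_def fun_eq_iff)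
qed

lemma differences_affine:
  fixes f :: "(nat \<Rightarrow> int) \<Rightarrow> int"
  shows "differences hs (\<lambda>y. f (affine_map b cs y)) a
    = differences (map (\<lambda>h. lin_comb h cs) hs) f (affine_map b cs a)"
  by (induction hs arbitrary: a) (auto simp: difference_def lin_comb_add add.assoc)

context prime_modulus begin

lemma mod_vec_lin_comb_mod_vec:
  assumes "length cs = r"
  shows "mod_vec p n (affine_map b cs (mod_vec p r y)) = mod_vec p n (affine_map b cs y)"
  unfolding mod_vec_eq_iff
  using assms by (auto simp: lin_comb_def mod_vec_def intro!: cong_add cong_sum cong_scalar_right)

lemma periodic_mod_affine:
  assumes "vec.periodic_mod n q f" "length cs = r"
  shows "vec.periodic_mod r q (\<lambda>y. f (affine_map b cs y))"
  unfolding vec.periodic_mod_def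
  by (intro allI vec.periodic_mod_cong_if_red_eq[OF assms(1)] mod_vec_lin_comb_mod_vec[OF assms(2)])

lemma low_degree_affine:
  assumes "low_degree n d g" "length cs = r"
  shows "low_degree r d (\<lambda>y. g (affine_map b cs y))"
  using assms periodic_mod_affine[of n _ g cs r b]
  by (simp add: vec.low_degree_def vanishing_differences_def differences_affine)

lemma nonvanishing_prob_le_avg_misfit_prob:
  assumes m: "sufficient_samples r d m" and f: "vec.periodic_mod n (int p) f" and r: "Suc d \<le> r"
  shows "vec.nonvanishing_prob n (int p) (Suc d) f \<le> 2 ^ (d + 2) *
     avg (vecs p n) (\<lambda>b. avg (nlists r (vecs p n))
       (\<lambda>cs. misfit_prob r d m (\<lambda>y. f (affine_map b cs y))))"
proof -
  let ?X = "vecs p n" and ?L = "nlists r (vecs p n)" and ?us = "map unit_vec [0..<Suc d]"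
  define nz where "nz cs b \<longleftrightarrow> [differences (take (Suc d) cs) f b \<noteq> 0] (mod int p)" for cs b
  have periodic: "vec.periodic n (nz cs)" for cs
    using vec.periodic_cong_0[OF vec.periodic_mod_differences[OF f]]
    by (simp add: nz_def vec.periodic_def)
  have affine: "nz cs (affine_map b cs a)
      \<longleftrightarrow> [differences ?us (\<lambda>y. f (affine_map b cs y)) a \<noteq> 0] (mod int p)"
    if "length cs = r" for cs a b
  proof -
    have "map (\<lambda>h. lin_comb h cs) ?us = take (Suc d) cs"
      using r that by (intro nth_equalityI) (auto simp: lin_comb_unit_vec simp del: upt_Suc)
    then show ?thesis unfolding differences_affine nz_def by simp
  qed
  have "vec.nonvanishing_prob n (int p) (Suc d) f = avg ?X (\<lambda>b. proportion ?L (\<lambda>cs. nz cs b))"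
    unfolding vec.nonvanishing_prob_def vec.nonvanishing_at_def nz_def
    by (rule avg_cong, rule avg_nlists_take[OF _ _ r, symmetric]) auto
  also have "\<dots> = avg ?L (\<lambda>cs. avg (vecs p r) (\<lambda>a. proportion ?X (nz cs)))"
    by (subst avg_swap) simp
  also have "\<dots> = avg ?L (\<lambda>cs. avg (vecs p r) (\<lambda>a. proportion ?X (\<lambda>b. nz cs (affine_map b cs a))))"
    by (simp add: vec.proportion_shift[OF periodic])
  also have "\<dots> = avg ?X (\<lambda>b. avg ?L (\<lambda>cs. proportion (vecs p r) (\<lambda>a. nz cs (affine_map b cs a))))"
    by (subst avg_swap[of ?X]) (intro avg_cong avg_swap)
  also have "\<dots> \<le> avg ?X (\<lambda>b. avg ?L
      (\<lambda>cs. 2 ^ (d + 2) * misfit_prob r d m (\<lambda>y. f (affine_map b cs y))))"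
  proof (intro avg_mono)
    fix b cs assume "cs \<in> ?L"
    then have len: "length cs = r" by simp
    show "proportion (vecs p r) (\<lambda>a. nz cs (affine_map b cs a))
        \<le> 2 ^ (d + 2) * misfit_prob r d m (\<lambda>y. f (affine_map b cs y))"
      unfolding affine[OF len]
      by (rule proportion_differences_le_misfit_prob[OF m periodic_mod_affine[OF f len]]) simp
  qed
  finally show ?thesis unfolding avg_cmult .
qed

definition kernel_prob :: "nat \<Rightarrow> nat \<Rightarrow> (nat \<Rightarrow> int) list \<Rightarrow> real" where
  "kernel_prob n r cs = proportion (vecs p r) (\<lambda>y. mod_vec p n (lin_comb y cs) = mod_vec p n 0)"

lemma proportion_fiber_le_kernel_prob:
  assumes len: "length cs = r"
  shows "proportion (vecs p r) (\<lambda>y. to_point p n (affine_map b cs y) = z) \<le> kernel_prob n r cs"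
proof (cases "\<exists>y0. to_point p n (affine_map b cs y0) = z")
  case True
  then obtain y0 where y0: "to_point p n (affine_map b cs y0) = z" by blast
  let ?P = "\<lambda>y. mod_vec p n (affine_map b cs y) = mod_vec p n (affine_map b cs y0)"
  have "vec.periodic r ?P"
    unfolding vec.periodic_def by (simp add: mod_vec_lin_comb_mod_vec[OF len])
  then have "proportion (vecs p r) ?P = proportion (vecs p r) (\<lambda>y. ?P (y + y0))"
    by (rule vec.proportion_shift[symmetric])
  also have "\<dots> = kernel_prob n r cs"
    unfolding kernel_prob_def mod_vec_eq_iff lin_comb_add by (simp add: cong_iff_dvd_diff)
  finally show ?thesis by (simp add: y0[symmetric] to_point_eq_iff)
next
  case False
  then show ?thesis by (auto simp: kernel_prob_def intro: avg_nonneg)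
qed

lemma proportion_scaled_eq_0_le:
  assumes "\<not> int p dvd a"
  shows "proportion (vecs p n) (\<lambda>c. mod_vec p n ((\<lambda>i. a * c i) + w) = mod_vec p n 0) \<le> 1 / p ^ n"
proof -
  let ?S = "{c \<in> vecs p n. mod_vec p n ((\<lambda>i. a * c i) + w) = mod_vec p n 0}"
  have coprime: "coprime a (int p)"
    using assms prime_p by (metis coprime_commute prime_imp_coprime prime_nat_int_transfer)
  have "c = c'" if "c \<in> ?S" "c' \<in> ?S" for c c'
  proof -
    have "[c i = c' i] (mod int p)" if "i < n" for i
    proof -
      have "[a * c i + w i = a * c' i + w i] (mod int p)"
        using \<open>c \<in> ?S\<close> \<open>c' \<in> ?S\<close> that by (simp add: mod_vec_eq_iff cong_def)
      then show ?thesis using coprime by (simp add: cong_add_rcancel cong_mult_lcancel)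
    qed
    then have "mod_vec p n c = mod_vec p n c'" by (simp add: mod_vec_eq_iff)
    then show ?thesis using that by (simp add: vec.red_id)
  qed
  then have "card ?S \<le> Suc 0" by (subst card_le_Suc0_iff_eq) auto
  then show ?thesis by (simp add: proportion_eq_card card_vecs divide_right_mono)
qed

lemma proportion_lin_comb_eq_0_le:
  assumes "l < r" "\<not> int p dvd y l"
  shows "proportion (nlists r (vecs p n)) (\<lambda>cs. mod_vec p n (lin_comb y cs + w) = mod_vec p n 0)
    \<le> 1 / p ^ n"
  using assms
proof (induction r arbitrary: l y w)
  case (Suc r)
  let ?X = "vecs p n" and ?L = "nlists r (vecs p n)"
  let ?tail = "\<lambda>cs. lin_comb (\<lambda>l. y (Suc l)) cs + w"
  have Cons: "lin_comb y (c # cs) + w = (\<lambda>i. y 0 * c i) + ?tail cs" for c cs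
    by (simp add: lin_comb_Cons add.assoc)
  show ?case
  proof (cases "int p dvd y 0")
    case True
    then obtain l' where l': "l = Suc l'" using Suc.prems by (cases l) auto
    have "mod_vec p n ((\<lambda>i. y 0 * c i) + v) = mod_vec p n v" for c v
      using True by (simp add: mod_vec_eq_iff cong_iff_dvd_diff)
    then have "proportion (nlists (Suc r) ?X) (\<lambda>cs. mod_vec p n (lin_comb y cs + w) = mod_vec p n 0)
       = avg ?X (\<lambda>c. proportion ?L (\<lambda>cs. mod_vec p n (?tail cs) = mod_vec p n 0))"
      by (simp only: avg_nlists_Suc Cons)
    also have "\<dots> \<le> 1 / p ^ n"
      by (rule avg_le_const[OF _ _ Suc.IH[of l']]) (use Suc.prems l' in auto)
    finally show ?thesis .
  next
    case False
    have "proportion (nlists (Suc r) ?X) (\<lambda>cs. mod_vec p n (lin_comb y cs + w) = mod_vec p n 0)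
       = avg ?L (\<lambda>cs. proportion ?X
           (\<lambda>c. mod_vec p n ((\<lambda>i. y 0 * c i) + ?tail cs) = mod_vec p n 0))"
      unfolding avg_nlists_Suc Cons by (rule avg_swap)
    also have "\<dots> \<le> 1 / p ^ n"
      by (rule avg_le_const[OF _ _ proportion_scaled_eq_0_le[OF False]]) simp_all
    finally show ?thesis .
  qed
qed simp

lemma proportion_vecs_eq_0: "proportion (vecs p r) (\<lambda>y. y = 0) = 1 / p ^ r"
proof -
  have "{y \<in> vecs p r. y = 0} = {0}" by (auto simp: vecs_def)
  then show ?thesis by (simp add: proportion_eq_card card_vecs)
qed

lemma avg_kernel_prob_le:
  "avg (nlists r (vecs p n)) (kernel_prob n r) \<le> 2 / p ^ min r n"
proof -
  let ?L = "nlists r (vecs p n)"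
  let ?K = "\<lambda>y. proportion ?L (\<lambda>cs. mod_vec p n (lin_comb y cs + 0) = mod_vec p n 0)"
  have "avg ?L (kernel_prob n r) = avg (vecs p r) ?K"
    unfolding kernel_prob_def[abs_def] add_0_right by (rule avg_swap)
  also have "\<dots> \<le> avg (vecs p r) (\<lambda>y. of_bool (y = 0) + 1 / p ^ n)"
  proof (rule avg_mono)
    fix y assume y: "y \<in> vecs p r"
    show "?K y \<le> of_bool (y = 0) + 1 / p ^ n"
    proof (cases "y = 0")
      case True
      then show ?thesis
        using proportion_le_1[of ?L "\<lambda>cs. mod_vec p n (lin_comb y cs + 0) = mod_vec p n 0"]
        by (simp add: add_increasing2)
    next
      case False
      then obtain l where nz: "y l \<noteq> 0" by (auto simp: fun_eq_iff)
      then have l: "l < r" using y by (auto simp: vecs_def not_less[symmetric])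
      then have "0 < y l" "y l < int p" using y nz by (auto simp: vecs_def order_less_le)
      then have "\<not> int p dvd y l" by (rule zdvd_not_zless)
      then show ?thesis using proportion_lin_comb_eq_0_le[OF l, of y n 0] False by simp
    qed
  qed
  also have "\<dots> = 1 / p ^ r + 1 / p ^ n"
    by (simp add: avg_add proportion_vecs_eq_0)
  also have "\<dots> \<le> 1 / p ^ min r n + 1 / p ^ min r n"
    by (intro add_mono divide_left_mono power_increasing) (use p_ge_2 in auto)
  finally show ?thesis by simp
qed

end

section \<open>Non-adaptive testers against erasures\<close>

lemma cond_pmf_cond_pmf:
  assumes ne: "set_pmf D \<inter> T \<noteq> {}" and "T \<subseteq> S"
  shows "cond_pmf (cond_pmf D S) T = cond_pmf D T"
proof (rule pmf_eqI)
  fix x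
  have neS: "set_pmf D \<inter> S \<noteq> {}" using assms by blast
  have neT: "set_pmf (cond_pmf D S) \<inter> T \<noteq> {}"
    using assms by (simp add: set_cond_pmf[OF neS] Int_assoc Int_absorb1)
  have pos: "measure D S > 0" using neS by (meson disjoint_iff measure_pmf_posI)
  have "measure (cond_pmf D S) T = measure D T / measure D S"
    unfolding cond_pmf.rep_eq[OF neS] using pos \<open>T \<subseteq> S\<close>
    by (subst measure_uniform_measure) (auto simp: measure_pmf.emeasure_eq_measure Int_absorb1)
  then show "pmf (cond_pmf (cond_pmf D S) T) x = pmf (cond_pmf D T) x"
    using pos \<open>T \<subseteq> S\<close> by (auto simp: pmf_cond[OF neT] pmf_cond[OF neS] pmf_cond[OF ne])
qed

lemma bind_cond_pmf_fibers:
  assumes ne: "set_pmf D \<inter> S \<noteq> {}" and saturated: "\<And>x y. x \<in> S \<Longrightarrow> F y = F x \<Longrightarrow> y \<in> S"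
  shows "bind_pmf (cond_pmf D S) (\<lambda>x. cond_pmf D {y. F y = F x}) = cond_pmf D S"
proof -
  let ?P = "cond_pmf D S"
  have "cond_pmf D {y. F y = F x} = cond_pmf ?P {y. F y = F x}" if "x \<in> set_pmf ?P" for x
    using that saturated by (intro cond_pmf_cond_pmf[symmetric]) (auto simp: set_cond_pmf[OF ne])
  then have "bind_pmf ?P (\<lambda>x. cond_pmf D {y. F y = F x})
      = bind_pmf ?P (\<lambda>x. cond_pmf ?P {y. F y = F x})"
    by (intro bind_pmf_cong refl)
  also have "\<dots> = ?P"
    by (rule bind_cond_pmf_cancel) (auto intro!: arg_cong[where f = "measure_pmf.prob ?P"])
  finally show ?thesis .
qed

lemma bind_cond_pmf_take_Suc:
  assumes "set_pmf D \<inter> {xs. take l xs = ps} \<noteq> {}"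
  shows "bind_pmf (cond_pmf D {xs. take l xs = ps})
      (\<lambda>xs. cond_pmf D {ys. take (Suc l) ys = take (Suc l) xs})
    = cond_pmf D {xs. take l xs = ps}"
proof (rule bind_cond_pmf_fibers[OF assms, where F = "take (Suc l)"])
  fix xs ys
  assume xs: "xs \<in> {xs. take l xs = ps}" and eq: "take (Suc l) ys = take (Suc l) xs"
  have "take l ys = take l xs" using arg_cong[OF eq, of "take l"] by simp
  with xs show "ys \<in> {xs. take l xs = ps}" by simp
qed

type_synonym adversary = "hist \<Rightarrow> nat list set"
type_synonym state = "nat list set \<times> hist"

definition log_query :: "(nat list \<Rightarrow> nat) \<Rightarrow> nat list set \<Rightarrow> hist \<Rightarrow> nat list \<Rightarrow> hist" where
  "log_query f E h x = h @ [(x, if x \<in> E then None else Some (f x))]"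

fun step :: "adversary \<Rightarrow> (nat list \<Rightarrow> nat) \<Rightarrow> state \<Rightarrow> nat list \<Rightarrow> state" where
  "step A f (E, h) x = (E \<union> A (log_query f E h x), log_query f E h x)"

abbreviation run :: "adversary \<Rightarrow> (nat list \<Rightarrow> nat) \<Rightarrow> state \<Rightarrow> nat list list \<Rightarrow> state" where
  "run A f \<equiv> foldl (step A f)"

lemma run_drop:
  "l < length xs \<Longrightarrow> run A f \<sigma> (drop l xs) = run A f (step A f \<sigma> (xs ! l)) (drop (Suc l) xs)"
  by (simp flip: Cons_nth_drop_Suc)

lemma map_pmf_run_fiber:
  assumes longer: "\<And>ys. ys \<in> set_pmf D \<Longrightarrow> l < length ys" and xs: "xs \<in> set_pmf D"
  shows "map_pmf (\<lambda>ys. g (run A f (step A f \<sigma> (xs ! l)) (drop (Suc l) ys)))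
      (cond_pmf D {ys. take (Suc l) ys = take (Suc l) xs})
    = map_pmf (\<lambda>ys. g (run A f \<sigma> (drop l ys)))
      (cond_pmf D {ys. take (Suc l) ys = take (Suc l) xs})"
proof (intro map_pmf_cong refl)
  have fiber: "set_pmf D \<inter> {ys. take (Suc l) ys = take (Suc l) xs} \<noteq> {}" using xs by blast
  fix ys assume "ys \<in> set_pmf (cond_pmf D {ys. take (Suc l) ys = take (Suc l) xs})"
  then have ys: "ys \<in> set_pmf D" "take (Suc l) ys = take (Suc l) xs"
    by (simp_all add: set_cond_pmf[OF fiber])
  then have "ys ! l = xs ! l" by (metis lessI nth_take)
  then show "g (run A f (step A f \<sigma> (xs ! l)) (drop (Suc l) ys)) = g (run A f \<sigma> (drop l ys))"
    using run_drop[OF longer[OF ys(1)], of A f \<sigma>] by simp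
qed

text \<open>A distribution on query lists of length \<open>Q\<close> becomes a tester by drawing each query
  from its conditional distribution given the earlier ones, which are all in the history.\<close>
definition replay :: "nat list list pmf \<Rightarrow> nat \<Rightarrow> (hist \<Rightarrow> bool) \<Rightarrow> hist \<Rightarrow> action pmf" where
  "replay D Q dec h = (if length h < Q
     then map_pmf (\<lambda>xs. Query (xs ! length h)) (cond_pmf D {xs. take (length h) xs = map fst h})
     else return_pmf (Decide (dec h)))"

lemma exec_replay_Suc:
  assumes "length h < Q"
  shows "exec (replay D Q dec) A f E h (Suc k) =
    bind_pmf (cond_pmf D {xs. take (length h) xs = map fst h}) (\<lambda>xs.
      let h' = log_query f E h (xs ! length h) in exec (replay D Q dec) A f (E \<union> A h') h' k)"
  using assms by (simp add: replay_def bind_map_pmf Let_def log_query_def)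

lemma exec_replay:
  assumes len: "\<And>xs. xs \<in> set_pmf D \<Longrightarrow> length xs = Q"
    and "set_pmf D \<inter> {xs. take (length h) xs = map fst h} \<noteq> {}" and "length h + k = Q"
  shows "exec (replay D Q dec) A f E h k =
    map_pmf (\<lambda>xs. dec (snd (run A f (E, h) (drop (length h) xs))))
      (cond_pmf D {xs. take (length h) xs = map fst h})"
  using assms(2,3)
proof (induction k arbitrary: E h)
  case 0
  let ?P = "cond_pmf D {xs. take (length h) xs = map fst h}"
  have "map_pmf (\<lambda>xs. dec (snd (run A f (E, h) (drop (length h) xs)))) ?P = map_pmf (\<lambda>_. dec h) ?P"
    using 0 len by (intro map_pmf_cong refl) (simp add: set_cond_pmf)
  then show ?case using 0 by (simp add: replay_def)
next
  case (Suc k)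
  let ?l = "length h"
  let ?P = "cond_pmf D {xs. take ?l xs = map fst h}"
  let ?verdict = "\<lambda>xs. dec (snd (run A f (E, h) (drop ?l xs)))"
  let ?fiber = "\<lambda>xs. cond_pmf D {ys. take (Suc ?l) ys = take (Suc ?l) xs}"
  have next_query:
    "(let h' = log_query f E h (xs ! ?l) in exec (replay D Q dec) A f (E \<union> A h') h' k)
      = map_pmf ?verdict (?fiber xs)" if "xs \<in> set_pmf ?P" for xs
  proof -
    have xs: "xs \<in> set_pmf D" "take ?l xs = map fst h"
      using that by (simp_all add: set_cond_pmf[OF Suc.prems(1)])
    have longer: "?l < length ys" if "ys \<in> set_pmf D" for ys using len[OF that] Suc.prems(2) by simp
    have fiber: "set_pmf D \<inter> {ys. take (Suc ?l) ys = take (Suc ?l) xs} \<noteq> {}" using xs(1) by blast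
    let ?h = "log_query f E h (xs ! ?l)"
    have "map fst ?h = take (Suc ?l) xs" "length ?h = Suc ?l"
      using longer[OF xs(1)] xs(2) by (simp_all add: log_query_def take_Suc_conv_app_nth)
    then have "exec (replay D Q dec) A f (E \<union> A ?h) ?h k
        = map_pmf (\<lambda>ys. dec (snd (run A f (E \<union> A ?h, ?h) (drop (Suc ?l) ys)))) (?fiber xs)"
      using Suc.IH[of ?h "E \<union> A ?h"] Suc.prems(2) fiber by simp
    also have "\<dots> = map_pmf ?verdict (?fiber xs)"
      using map_pmf_run_fiber[OF longer xs(1), of "\<lambda>\<sigma>. dec (snd \<sigma>)" A f "(E, h)"] by simp
    finally show ?thesis by (simp only: Let_def)
  qed
  have "exec (replay D Q dec) A f E h (Suc k) = bind_pmf ?P (\<lambda>xs.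
      let h' = log_query f E h (xs ! ?l) in exec (replay D Q dec) A f (E \<union> A h') h' k)"
    using Suc.prems(2) by (intro exec_replay_Suc) simp
  also have "\<dots> = bind_pmf ?P (\<lambda>xs. map_pmf ?verdict (?fiber xs))"
    by (intro bind_pmf_cong refl next_query)
  also have "\<dots> = map_pmf ?verdict ?P"
    by (simp only: map_bind_pmf[symmetric] bind_cond_pmf_take_Suc[OF Suc.prems(1)])
  finally show ?case .
qed

definition answers :: "hist \<Rightarrow> (nat list \<times> nat) set" where
  "answers h = {(x, v). (x, Some v) \<in> set h}"

lemma answers_log_query:
  "answers (log_query f E h x) = answers h \<union> (if x \<in> E then {} else {(x, f x)})"
  by (auto simp: answers_def log_query_def)

lemma answers_run_mono: "answers h \<subseteq> answers (snd (run A f (E, h) xs))"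
proof (induction xs arbitrary: E h)
  case (Cons x xs)
  have "answers h \<subseteq> answers (log_query f E h x)" by (simp add: answers_log_query)
  with Cons show ?case by fastforce
qed simp

lemma answers_run_subset: "answers (snd (run A f (E, h) xs)) \<subseteq> answers h \<union> range (\<lambda>x. (x, f x))"
proof (induction xs arbitrary: E h)
  case (Cons x xs)
  have "answers (log_query f E h x) \<subseteq> answers h \<union> range (\<lambda>x. (x, f x))"
    by (auto simp: answers_log_query)
  with Cons show ?case by fastforce
qed simp

lemma card_erased_le:
  assumes "valid_adversary t A" "finite E"
  shows "finite (fst (run A f (E, h) xs)) \<and> card (fst (run A f (E, h) xs)) \<le> card E + t * length xs"
  using assms(2)
proof (induction xs arbitrary: E h)
  case (Cons x xs)
  let ?h = "log_query f E h x"
  have A: "finite (A ?h)" "card (A ?h) \<le> t" using assms(1) by (auto simp: valid_adversary_def)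
  have "card (E \<union> A ?h) \<le> card E + t" using card_Un_le[of E "A ?h"] A by simp
  with Cons.IH[of "E \<union> A ?h" ?h] Cons.prems A show ?case by simp
qed simp

fun unerased :: "('a list \<Rightarrow> 'a set) \<Rightarrow> 'a list \<Rightarrow> bool" where
  "unerased Er [] \<longleftrightarrow> True"
| "unerased Er (x # xs) \<longleftrightarrow> x \<notin> Er [] \<and> unerased (\<lambda>ys. Er (x # ys)) xs"

abbreviation true_answers :: "(nat list \<Rightarrow> nat) \<Rightarrow> nat list list \<Rightarrow> (nat list \<times> nat) set" where
  "true_answers f xs \<equiv> (\<lambda>x. (x, f x)) ` set xs"

lemma answers_run_unerased:
  "unerased (\<lambda>ys. fst (run A f (E, h) ys)) xs \<Longrightarrow>
   true_answers f xs \<subseteq> answers (snd (run A f (E, h) xs))"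
proof (induction xs arbitrary: E h)
  case (Cons x xs)
  then have "(x, f x) \<in> answers (log_query f E h x)" by (simp add: answers_log_query)
  then have "(x, f x) \<in> answers (snd (run A f (E, h) (x # xs)))"
    using answers_run_mono[of "log_query f E h x"] by fastforce
  moreover have "true_answers f xs \<subseteq> answers (snd (run A f (E, h) (x # xs)))"
    using Cons by simp
  ultimately show ?case by simp
qed simp

lemma proportion_not_unerased_le:
  assumes Y: "finite Y" "Y \<noteq> {}"
    and hit: "\<And>z. proportion Y (\<lambda>y. \<psi> y = z) \<le> \<kappa>"
    and Er: "\<And>xs. length xs < s \<Longrightarrow> finite (Er xs) \<and> card (Er xs) \<le> K"
  shows "proportion (nlists s Y) (\<lambda>ys. \<not> unerased Er (map \<psi> ys)) \<le> real s * real K * \<kappa>"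
  using Er
proof (induction s arbitrary: Er)
  case (Suc s)
  have "0 \<le> proportion Y (\<lambda>y. \<psi> y = undefined)" by (rule avg_nonneg) simp
  then have \<kappa>: "0 \<le> \<kappa>" using hit[of undefined] by (rule order_trans)
  have first: "proportion Y (\<lambda>y. \<psi> y \<in> Er []) \<le> K * \<kappa>"
  proof -
    have "proportion Y (\<lambda>y. \<psi> y \<in> Er []) \<le> (\<Sum>z\<in>Er []. proportion Y (\<lambda>y. \<psi> y = z))"
      using proportion_bex_le_sum[of "Er []" Y "\<lambda>z y. \<psi> y = z"] Suc.prems[of "[]"] by simp
    also have "\<dots> \<le> (\<Sum>z\<in>Er []. \<kappa>)" by (intro sum_mono hit)
    also have "\<dots> \<le> K * \<kappa>" using Suc.prems[of "[]"] \<kappa> by (simp add: mult_right_mono)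
    finally show ?thesis .
  qed
  have rest: "proportion (nlists s Y) (\<lambda>ys. \<not> unerased (\<lambda>zs. Er (\<psi> y # zs)) (map \<psi> ys))
      \<le> real s * real K * \<kappa>" for y
    by (intro Suc.IH Suc.prems) simp
  have "proportion (nlists (Suc s) Y) (\<lambda>ys. \<not> unerased Er (map \<psi> ys))
     \<le> avg Y (\<lambda>y. proportion (nlists s Y) (\<lambda>_. \<psi> y \<in> Er []) +
         proportion (nlists s Y) (\<lambda>ys. \<not> unerased (\<lambda>zs. Er (\<psi> y # zs)) (map \<psi> ys)))"
    unfolding avg_nlists_Suc by (intro avg_mono proportion_le_add) auto
  also have "\<dots> \<le> avg Y (\<lambda>y. of_bool (\<psi> y \<in> Er []) + real s * real K * \<kappa>)"
    using rest Y by (intro avg_mono add_mono) simp_all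
  also have "\<dots> \<le> K * \<kappa> + real s * real K * \<kappa>"
    using first Y by (simp add: avg_add)
  finally show ?case by (simp add: algebra_simps)
qed (simp add: Y)

definition consistent :: "nat \<Rightarrow> nat \<Rightarrow> nat \<Rightarrow> (nat list \<times> nat) set \<Rightarrow> bool" where
  "consistent p n d S \<longleftrightarrow> (\<exists>G. is_fn p n G \<and> deg_le p n d G \<and> (\<forall>x v. (x, v) \<in> S \<longrightarrow> G x = v))"

lemma consistent_subset: "consistent p n d S \<Longrightarrow> S' \<subseteq> S \<Longrightarrow> consistent p n d S'"
  unfolding consistent_def by blast

definition block_rejects ::
  "nat \<Rightarrow> nat \<Rightarrow> nat \<Rightarrow> (nat list \<Rightarrow> nat) \<Rightarrow> (nat list list \<Rightarrow> nat list set) \<Rightarrow> nat list list \<Rightarrow> bool"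
where
  "block_rejects p n d f Er xs \<longleftrightarrow> unerased Er xs \<and> \<not> consistent p n d (true_answers f xs)"

lemma inconsistent_after_rejecting_block:
  assumes "block_rejects p n d f (\<lambda>ys. fst (run A f (E, h) ys)) xs"
  shows "\<not> consistent p n d (answers (snd (run A f (E, h) (xs @ zs))))"
proof
  assume consistent: "consistent p n d (answers (snd (run A f (E, h) (xs @ zs))))"
  obtain E' h' where run: "run A f (E, h) xs = (E', h')" by fastforce
  have "true_answers f xs \<subseteq> answers h'"
    using answers_run_unerased[of A f E h xs] assms run by (simp add: block_rejects_def)
  also have "\<dots> \<subseteq> answers (snd (run A f (E, h) (xs @ zs)))"
    using answers_run_mono[of h'] by (simp add: run)
  finally have "consistent p n d (true_answers f xs)"
    by (rule consistent_subset[OF consistent])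
  with assms show False by (simp add: block_rejects_def)
qed

text \<open>\<open>Er\<close> maps the earlier queries of a block to the points erased by then.\<close>
definition rejecting_blocks ::
  "nat \<Rightarrow> nat \<Rightarrow> nat \<Rightarrow> (nat list \<Rightarrow> nat) \<Rightarrow> nat \<Rightarrow> nat \<Rightarrow> real \<Rightarrow> 'a set \<Rightarrow> ('a \<Rightarrow> nat list list) \<Rightarrow> bool"
where
  "rejecting_blocks p n d f s K \<rho> \<Omega> blk \<longleftrightarrow>
     (\<forall>Er. (\<forall>xs. length xs < s \<longrightarrow> finite (Er xs) \<and> card (Er xs) \<le> K) \<longrightarrow>
       \<rho> \<le> proportion \<Omega> (\<lambda>\<omega>. block_rejects p n d f Er (blk \<omega>)))"

lemma rejecting_blocks_mono:
  "rejecting_blocks p n d f s K \<rho>' \<Omega> blk \<Longrightarrow> \<rho> \<le> \<rho>' \<Longrightarrow> rejecting_blocks p n d f s K \<rho> \<Omega> blk"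
  unfolding rejecting_blocks_def by (meson order_trans)

lemma proportion_block_rejects_ge:
  assumes adv: "valid_adversary t A" and rej: "rejecting_blocks p n d f s K \<rho> \<Omega> blk"
    and "finite E" and budget: "card E + t * s \<le> K"
  shows "\<rho> \<le> proportion \<Omega> (\<lambda>\<omega>. block_rejects p n d f (\<lambda>ys. fst (run A f (E, h) ys)) (blk \<omega>))"
proof -
  let ?erased = "\<lambda>ys. fst (run A f (E, h) ys)"
  have "finite (?erased ys) \<and> card (?erased ys) \<le> K" if "length ys < s" for ys
  proof -
    have "t * length ys \<le> t * s" using that by simp
    then show ?thesis
      using card_erased_le[OF adv \<open>finite E\<close>, of f h ys] budget by linarith
  qed
  then show ?thesis by (rule rej[unfolded rejecting_blocks_def, rule_format])
qed

lemma blocks_soundness: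
  fixes s B :: nat
  assumes \<Omega>: "finite \<Omega>" "\<Omega> \<noteq> {}" and len: "\<And>\<omega>. \<omega> \<in> \<Omega> \<Longrightarrow> length (blk \<omega>) = s"
    and adv: "valid_adversary t A"
    and rej: "rejecting_blocks p n d f s (t * (s * B)) \<rho> \<Omega> blk" and \<rho>: "\<rho> \<le> 1"
    and "b \<le> B" "finite E" "card E \<le> t * (s * (B - b))"
  shows "proportion (nlists b \<Omega>)
      (\<lambda>\<omega>s. consistent p n d (answers (snd (run A f (E, h) (concat (map blk \<omega>s)))))) \<le> (1 - \<rho>) ^ b"
  using assms(7-)
proof (induction b arbitrary: E h)
  case 0
  show ?case by simp
next
  case (Suc b)
  let ?L = "nlists b \<Omega>"
  let ?accept = "\<lambda>\<omega>s. consistent p n d (answers (snd (run A f (E, h) (concat (map blk \<omega>s)))))"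
  let ?rej = "\<lambda>\<omega>. block_rejects p n d f (\<lambda>ys. fst (run A f (E, h) ys)) (blk \<omega>)"
  have "B - b = Suc (B - Suc b)" using Suc.prems by simp
  then have budget: "card E + t * s \<le> t * (s * (B - b))"
    using Suc.prems by (simp add: algebra_simps)
  have after_block: "proportion ?L (\<lambda>\<omega>s. ?accept (\<omega> # \<omega>s)) \<le> (1 - \<rho>) ^ b * of_bool (\<not> ?rej \<omega>)"
    if \<omega>: "\<omega> \<in> \<Omega>" for \<omega>
  proof (cases "?rej \<omega>")
    case True
    then show ?thesis
      using inconsistent_after_rejecting_block[OF True] by (simp add: avg_def del: foldl_append)
  next
    case False
    obtain E' h' where run: "run A f (E, h) (blk \<omega>) = (E', h')" by fastforce
    have "finite E'" "card E' \<le> t * (s * (B - b))"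
      using card_erased_le[OF adv Suc.prems(2), of f h "blk \<omega>"] run len[OF \<omega>] budget by auto
    then show ?thesis using Suc.IH[of E' h'] Suc.prems(1) False by (simp add: run)
  qed
  have "t * (s * (B - b)) \<le> t * (s * B)" by simp
  then have rej_ge: "\<rho> \<le> proportion \<Omega> ?rej"
    by (intro proportion_block_rejects_ge[OF adv rej Suc.prems(2)] order_trans[OF budget])
  have "proportion (nlists (Suc b) \<Omega>) ?accept \<le> avg \<Omega> (\<lambda>\<omega>. (1 - \<rho>) ^ b * of_bool (\<not> ?rej \<omega>))"
    unfolding avg_nlists_Suc by (intro avg_mono after_block)
  also have "\<dots> = (1 - \<rho>) ^ b * (1 - proportion \<Omega> ?rej)"
    unfolding avg_cmult proportion_not[OF \<Omega>] ..
  also have "\<dots> \<le> (1 - \<rho>) ^ b * (1 - \<rho>)"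
    using rej_ge \<rho> by (intro mult_left_mono) simp_all
  finally show ?case by (simp add: mult.commute)
qed

definition valid_tester ::
  "nat \<Rightarrow> nat \<Rightarrow> nat \<Rightarrow> real \<Rightarrow> nat \<Rightarrow> (hist \<Rightarrow> action pmf) \<Rightarrow> nat \<Rightarrow> bool"
where
  "valid_tester p n d \<delta> t T q \<longleftrightarrow> query_bounded T q \<and>
     (\<forall>f A. is_fn p n f \<and> deg_le p n d f \<and> valid_adversary t A \<longrightarrow>
        accept_prob T q A f = 1) \<and>
     (\<forall>f A. is_fn p n f \<and> far_from_deg p n d \<delta> f \<and> valid_adversary t A \<longrightarrow>
        reject_prob T q A f \<ge> 2 / 3)"

lemma exec_replay_uniform:
  assumes \<Omega>: "finite \<Omega>" "\<Omega> \<noteq> {}" and len: "\<And>\<omega>. \<omega> \<in> \<Omega> \<Longrightarrow> length (qs \<omega>) = Q"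
  shows "measure_pmf.prob (exec (replay (map_pmf qs (pmf_of_set \<Omega>)) Q dec) A f {} [] Q) {c}
    = proportion \<Omega> (\<lambda>\<omega>. dec (snd (run A f ({}, []) (qs \<omega>))) = c)"
proof -
  let ?D = "map_pmf qs (pmf_of_set \<Omega>)"
  have "cond_pmf ?D UNIV = ?D"
    by (rule pmf_eqI) (simp add: pmf_cond set_pmf_not_empty)
  then have "exec (replay ?D Q dec) A f {} [] Q
      = map_pmf (\<lambda>\<omega>. dec (snd (run A f ({}, []) (qs \<omega>)))) (pmf_of_set \<Omega>)"
    using exec_replay[of ?D Q "[]" Q dec A f "{}"] len \<Omega>
    by (auto simp: map_pmf_comp set_pmf_not_empty)
  then show ?thesis
    using \<Omega> by (simp add: measure_pmf_of_set proportion_eq_card Int_def vimage_def)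
qed

lemma tester_from_blocks:
  fixes s B :: nat
  assumes \<Omega>: "finite \<Omega>" "\<Omega> \<noteq> {}" and len: "\<And>\<omega>. \<omega> \<in> \<Omega> \<Longrightarrow> length (blk \<omega>) = s"
    and rej: "\<And>f. is_fn p n f \<Longrightarrow> far_from_deg p n d \<delta> f \<Longrightarrow>
      rejecting_blocks p n d f s (t * (s * B)) \<rho> \<Omega> blk"
    and \<rho>: "\<rho> \<le> 1" and B: "(1 - \<rho>) ^ B \<le> 1 / 3"
  shows "\<exists>T. valid_tester p n d \<delta> t T (s * B)"
proof -
  let ?L = "nlists B \<Omega>" and ?qs = "\<lambda>\<omega>s. concat (map blk \<omega>s)"
  let ?dec = "\<lambda>h. consistent p n d (answers h)"
  define T where "T = replay (map_pmf ?qs (pmf_of_set ?L)) (s * B) ?dec"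
  have "length (?qs \<omega>s) = s * length \<omega>s" if "set \<omega>s \<subseteq> \<Omega>" for \<omega>s
    using that by (induction \<omega>s) (auto simp: len)
  then have prob: "measure_pmf.prob (exec T A f {} [] (s * B)) {c} =
      proportion ?L (\<lambda>\<omega>s. ?dec (snd (run A f ({}, []) (?qs \<omega>s))) = c)" for A f c
    unfolding T_def using \<Omega> by (intro exec_replay_uniform) auto
  have "valid_tester p n d \<delta> t T (s * B)"
    unfolding valid_tester_def
  proof (intro conjI allI impI; (elim conjE)?)
    show "query_bounded T (s * B)" by (auto simp: query_bounded_def T_def replay_def)
    fix f A
    assume fn: "is_fn p n f" and adv: "valid_adversary t A"
    show "accept_prob T (s * B) A f = 1" if "deg_le p n d f"
    proof -
      have "answers (snd (run A f ({}, []) xs)) \<subseteq> range (\<lambda>x. (x, f x))" for xs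
        using answers_run_subset[of A f "{}" "[]" xs] by (simp add: answers_def)
      then have "?dec (snd (run A f ({}, []) xs))" for xs
        unfolding consistent_def using fn that by (intro exI[of _ f]) blast
      then show ?thesis unfolding accept_prob_def prob using \<Omega> by simp
    qed
    show "reject_prob T (s * B) A f \<ge> 2 / 3" if "far_from_deg p n d \<delta> f"
    proof -
      have "proportion ?L (\<lambda>\<omega>s. ?dec (snd (run A f ({}, []) (?qs \<omega>s)))) \<le> (1 - \<rho>) ^ B"
        by (rule blocks_soundness[OF \<Omega> len adv rej[OF fn that] \<rho>]) simp_all
      then show ?thesis unfolding reject_prob_def prob using B \<Omega> by (simp add: proportion_not)
    qed
  qed
  then show ?thesis by blast
qed

section \<open>The affine block tester\<close>

lemma power_one_minus_le_third:
  fixes \<rho> :: real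
  assumes "\<rho> \<le> 1" "2 \<le> \<rho> * B" shows "(1 - \<rho>) ^ B \<le> 1 / 3"
proof -
  have "(1 - \<rho>) ^ B \<le> exp (- \<rho>) ^ B"
    using exp_ge_add_one_self[of "- \<rho>"] assms by (intro power_mono) auto
  also have "\<dots> = exp (- (\<rho> * B))" by (simp add: exp_of_nat_mult[symmetric] mult.commute)
  also have "\<dots> \<le> exp (- 2)" using assms by simp
  also have "\<dots> \<le> 1 / 3"
    using exp_ge_add_one_self[of "2::real"] by (simp add: exp_minus field_simps)
  finally show ?thesis .
qed

context prime_modulus begin

lemma misfit_prob_minus_erasures_le:
  fixes \<kappa> :: real
  assumes fit: "\<And>ys. consistent p n d (true_answers f (map \<psi> ys)) \<Longrightarrow> fits r d F ys"
    and hit: "\<And>z. proportion (vecs p r) (\<lambda>y. \<psi> y = z) \<le> \<kappa>"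
    and Er: "\<And>xs. length xs < Suc m \<Longrightarrow> finite (Er xs) \<and> card (Er xs) \<le> K"
  shows "misfit_prob r d m F - real (Suc m) * real K * \<kappa>
     \<le> proportion (nlists (Suc m) (vecs p r)) (\<lambda>ys. block_rejects p n d f Er (map \<psi> ys))"
proof -
  let ?L = "nlists (Suc m) (vecs p r)"
  have "misfit_prob r d m F \<le> proportion ?L (\<lambda>ys. block_rejects p n d f Er (map \<psi> ys)) +
      proportion ?L (\<lambda>ys. \<not> unerased Er (map \<psi> ys))"
    unfolding misfit_prob_def block_rejects_def using fit by (intro proportion_le_add) blast
  also have "proportion ?L (\<lambda>ys. \<not> unerased Er (map \<psi> ys)) \<le> real (Suc m) * real K * \<kappa>"
    by (rule proportion_not_unerased_le[OF vec.finite_X vec.X_nonempty hit Er])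
  finally show ?thesis by simp
qed

lemma fits_affine_if_consistent:
  assumes len: "length cs = r"
    and consistent:
      "consistent p n d (true_answers f (map (\<lambda>y. to_point p n (affine_map b cs y)) ys))"
  shows "fits r d (\<lambda>y. lift p n f (affine_map b cs y)) ys"
proof -
  obtain G where G: "is_fn p n G" "deg_le p n d G"
    "\<forall>y\<in>set ys. G (to_point p n (affine_map b cs y)) = f (to_point p n (affine_map b cs y))"
    using consistent unfolding consistent_def by auto
  have "low_degree r d (\<lambda>y. lift p n G (affine_map b cs y))"
    using G(1,2) len by (intro low_degree_affine) (simp_all add: deg_le_iff_low_degree)
  then show ?thesis unfolding fits_def using G(3) by (auto simp: lift_def)
qed

definition affine_sample ::
  "nat \<Rightarrow> nat \<Rightarrow> nat \<Rightarrow> ((nat \<Rightarrow> int) \<times> (nat \<Rightarrow> int) list \<times> (nat \<Rightarrow> int) list) set"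
where
  "affine_sample n r s = vecs p n \<times> nlists r (vecs p n) \<times> nlists s (vecs p r)"

definition affine_block ::
  "nat \<Rightarrow> (nat \<Rightarrow> int) \<times> (nat \<Rightarrow> int) list \<times> (nat \<Rightarrow> int) list \<Rightarrow> nat list list"
where
  "affine_block n = (\<lambda>(b, cs, ys). map (\<lambda>y. to_point p n (affine_map b cs y)) ys)"

definition block_rejection :: "nat \<Rightarrow> real" where
  "block_rejection d = robustness (Suc d) / 2 ^ (d + 2)"

lemma block_rejection_pos: "0 < block_rejection d"
  unfolding block_rejection_def using robustness_pos[of "Suc d"] by simp

lemma block_rejection_le_1: "block_rejection d \<le> 1"
proof -
  have "robustness (Suc d) \<le> 1" using robustness_le_half[of d] by simp
  also have "(1::real) \<le> 2 ^ (d + 2)" by (rule one_le_power) simp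
  finally show ?thesis unfolding block_rejection_def by (subst divide_le_eq_1) auto
qed

lemma avg_misfit_prob_ge_block_rejection:
  assumes f: "is_fn p n f" "far_from_deg p n d \<delta> f" and \<delta>: "0 < \<delta>" "\<delta> \<le> 1"
    and m: "sufficient_samples r d m" and r: "Suc d \<le> r"
  shows "block_rejection d * \<delta> \<le> avg (vecs p n) (\<lambda>b. avg (nlists r (vecs p n))
      (\<lambda>cs. misfit_prob r d m (\<lambda>y. lift p n f (affine_map b cs y))))"
  using order_trans[OF nonvanishing_prob_ge_if_far[OF f \<delta>]
      nonvanishing_prob_le_avg_misfit_prob[OF m periodic_mod_lift r]]
  by (simp add: block_rejection_def divide_le_eq mult.commute)

lemma rejecting_affine_blocks:
  assumes f: "is_fn p n f" "far_from_deg p n d \<delta> f" and \<delta>: "0 < \<delta>" "\<delta> \<le> 1"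
    and m: "sufficient_samples r d m" and r: "Suc d \<le> r"
  shows "rejecting_blocks p n d f (Suc m) K
     (block_rejection d * \<delta> - real (Suc m) * real K * (2 / p ^ min r n))
     (affine_sample n r (Suc m)) (affine_block n)"
  unfolding rejecting_blocks_def
proof (intro allI impI)
  fix Er :: "nat list list \<Rightarrow> nat list set"
  assume Er: "\<forall>xs. length xs < Suc m \<longrightarrow> finite (Er xs) \<and> card (Er xs) \<le> K"
  let ?X = "vecs p n" and ?L = "nlists r (vecs p n)"
  let ?misfit = "\<lambda>b cs. misfit_prob r d m (\<lambda>y. lift p n f (affine_map b cs y))"
  have "block_rejection d * \<delta> - real (Suc m) * real K * (2 / p ^ min r n)
      \<le> avg ?X (\<lambda>b. avg ?L (?misfit b)) - real (Suc m) * real K * avg ?L (kernel_prob n r)"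
    using avg_misfit_prob_ge_block_rejection[OF f \<delta> m r] avg_kernel_prob_le
    by (intro diff_mono mult_left_mono) simp_all
  also have "\<dots> = avg ?X (\<lambda>b. avg ?L
      (\<lambda>cs. ?misfit b cs - real (Suc m) * real K * kernel_prob n r cs))"
    by (simp only: avg_diff avg_cmult avg_const vec.finite_X vec.X_nonempty simp_thms)
  also have "\<dots> \<le> avg ?X (\<lambda>b. avg ?L (\<lambda>cs. proportion (nlists (Suc m) (vecs p r))
        (\<lambda>ys. block_rejects p n d f Er (map (\<lambda>y. to_point p n (affine_map b cs y)) ys))))"
  proof (intro avg_mono misfit_prob_minus_erasures_le)
    fix b cs assume "cs \<in> ?L"
    then have len: "length cs = r" by simp
    show "fits r d (\<lambda>y. lift p n f (affine_map b cs y)) ys"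
      if "consistent p n d (true_answers f (map (\<lambda>y. to_point p n (affine_map b cs y)) ys))"
      for ys
      by (rule fits_affine_if_consistent[OF len that])
    show "proportion (vecs p r) (\<lambda>y. to_point p n (affine_map b cs y) = z) \<le> kernel_prob n r cs"
      for z
      by (rule proportion_fiber_le_kernel_prob[OF len])
  qed (use Er in blast)
  also have "\<dots> = proportion (affine_sample n r (Suc m))
      (\<lambda>\<omega>. block_rejects p n d f Er (affine_block n \<omega>))"
    unfolding affine_sample_def affine_block_def avg_Times by simp
  finally show "block_rejection d * \<delta> - real (Suc m) * real K * (2 / p ^ min r n)
      \<le> proportion (affine_sample n r (Suc m)) (\<lambda>\<omega>. block_rejects p n d f Er (affine_block n \<omega>))" .
qed

definition samples :: "nat \<Rightarrow> nat \<Rightarrow> nat" where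
  "samples r d = nat \<lceil>2 ^ d * (card (exponents p r d) * ln p + 1)\<rceil>"

definition block_size :: "nat \<Rightarrow> nat \<Rightarrow> nat" where
  "block_size r d = Suc (samples r d)"

lemma ln_p_nonneg: "0 \<le> ln (real p)"
  using p_ge_2 by simp

lemma sufficient_samples_samples: "sufficient_samples r d (samples r d)"
proof -
  let ?M = "card (exponents p r d)" and ?m = "samples r d"
  have m: "2 ^ d * (?M * ln p + 1) \<le> ?m" unfolding samples_def by (rule real_nat_ceiling_ge)
  have "(1 - 1 / 2 ^ d :: real) ^ ?m \<le> exp (- 1 / 2 ^ d) ^ ?m"
    using exp_ge_add_one_self[of "- 1 / 2 ^ d"] by (intro power_mono) auto
  also have "\<dots> = exp (- (?m / 2 ^ d))" by (simp add: exp_of_nat_mult[symmetric])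
  also have "\<dots> \<le> exp (- (?M * ln p + 1))" using m by (simp add: field_simps)
  finally have "real p ^ ?M * (1 - 1 / 2 ^ d) ^ ?m \<le> real p ^ ?M * exp (- (?M * ln p + 1))"
    by (intro mult_left_mono) auto
  also have "\<dots> = exp (?M * ln p) * exp (- (?M * ln p + 1))" by (simp add: exp_of_nat_mult)
  also have "\<dots> = exp (-1)" by (simp flip: exp_add)
  also have "\<dots> \<le> (1::real) / 2"
    using exp_ge_add_one_self[of "1::real"] by (simp add: exp_minus field_simps)
  finally show ?thesis
    unfolding sufficient_samples_def using proportion_not_unisolvent_le[of ?m r d] by simp
qed

text \<open>
  For block size \<open>s\<close>, \<open>\<rho> = block_rejection d * \<delta>\<close> and \<open>B \<le> 5 / \<rho>\<close> blocks, a block has an erased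
  query with probability at most \<open>s * (t * (s * B)) * (2 / p ^ min r n)\<close>; the constant 20 makes
  this at most \<open>\<rho> / 2\<close>.
\<close>
definition rank_suffices :: "nat \<Rightarrow> nat \<Rightarrow> real \<Rightarrow> nat \<Rightarrow> nat \<Rightarrow> bool" where
  "rank_suffices n d \<delta> t r \<longleftrightarrow> Suc d \<le> r \<and>
     20 * real (block_size r d) ^ 2 * real t \<le> (block_rejection d * \<delta>) ^ 2 * real p ^ min r n"

lemma block_erasure_prob_le:
  fixes B :: nat
  assumes rank: "rank_suffices n d \<delta> t r" and "0 < \<delta>" and B: "B \<le> 5 / (block_rejection d * \<delta>)"
  shows "real (block_size r d) * real (t * (block_size r d * B)) * (2 / p ^ min r n)
    \<le> block_rejection d * \<delta> / 2"
proof -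
  define \<rho> where "\<rho> = block_rejection d * \<delta>"
  let ?s = "real (block_size r d)"
  have \<rho>: "0 < \<rho>" unfolding \<rho>_def using block_rejection_pos[of d] \<open>0 < \<delta>\<close> by simp
  have "?s * real (t * (block_size r d * B)) = ?s ^ 2 * t * B" by (simp add: power2_eq_square)
  also have "\<dots> \<le> ?s ^ 2 * t * (5 / \<rho>)"
    unfolding \<rho>_def by (rule mult_left_mono[OF B]) simp
  also have "\<dots> = 20 * ?s ^ 2 * t / (4 * \<rho>)" by simp
  also have "\<dots> \<le> \<rho> ^ 2 * p ^ min r n / (4 * \<rho>)"
    using rank \<rho> by (intro divide_right_mono) (simp_all add: rank_suffices_def \<rho>_def)
  also have "\<dots> = \<rho> / 4 * p ^ min r n" using \<rho> by (simp add: power2_eq_square)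
  finally show ?thesis by (simp add: divide_le_eq \<rho>_def)
qed

lemma affine_tester:
  assumes \<delta>: "0 < \<delta>" "\<delta> \<le> 1" and rank: "rank_suffices n d \<delta> t r"
  shows "\<exists>T q. real q \<le> 5 * block_size r d / (block_rejection d * \<delta>) \<and> valid_tester p n d \<delta> t T q"
proof -
  define \<rho> where "\<rho> = block_rejection d * \<delta>"
  define B where "B = nat \<lceil>4 / \<rho>\<rceil>"
  let ?s = "block_size r d" and ?\<Omega> = "affine_sample n r (block_size r d)"
  let ?K = "t * (block_size r d * B)"
  have \<rho>: "0 < \<rho>" "\<rho> \<le> 1"
    unfolding \<rho>_def using block_rejection_pos[of d] block_rejection_le_1[of d] \<delta>
    by (auto intro: mult_le_one)
  have B_ge: "4 / \<rho> \<le> B" unfolding B_def by (rule real_nat_ceiling_ge)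
  have "B \<le> 4 / \<rho> + 1" unfolding B_def using \<rho> by simp
  also have "\<dots> \<le> 5 / \<rho>" using \<rho> by (simp add: field_simps)
  finally have B_le: "B \<le> 5 / \<rho>" .
  have "\<exists>T. valid_tester p n d \<delta> t T (?s * B)"
  proof (rule tester_from_blocks[where \<rho> = "\<rho> / 2" and blk = "affine_block n" and \<Omega> = ?\<Omega>])
    fix f assume f: "is_fn p n f" "far_from_deg p n d \<delta> f"
    have "rejecting_blocks p n d f ?s ?K
        (\<rho> - real ?s * real ?K * (2 / p ^ min r n)) ?\<Omega> (affine_block n)"
      unfolding \<rho>_def block_size_def using rank
      by (intro rejecting_affine_blocks[OF f \<delta> sufficient_samples_samples])
        (simp add: rank_suffices_def)
    moreover have "real ?s * real ?K * (2 / p ^ min r n) \<le> \<rho> / 2"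
      unfolding \<rho>_def by (rule block_erasure_prob_le[OF rank \<delta>(1) B_le[unfolded \<rho>_def]])
    ultimately show "rejecting_blocks p n d f ?s ?K (\<rho> / 2) ?\<Omega> (affine_block n)"
      by (elim rejecting_blocks_mono) simp
  next
    show "(1 - \<rho> / 2) ^ B \<le> 1 / 3"
      using B_ge \<rho> by (intro power_one_minus_le_third) (auto simp: field_simps)
    show "length (affine_block n \<omega>) = ?s" if "\<omega> \<in> ?\<Omega>" for \<omega>
      using that by (auto simp: affine_block_def affine_sample_def)
  qed (use \<rho> in \<open>simp_all add: affine_sample_def\<close>)
  moreover have "real (?s * B) \<le> 5 * ?s / \<rho>"
    using mult_left_mono[OF B_le, of ?s] by (simp add: mult.commute)
  ultimately show ?thesis unfolding \<rho>_def by blast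
qed

end

section \<open>Choice of parameters\<close>

context prime_modulus begin

lemma card_exponents_le:
  fixes y :: real
  assumes y: "0 < y" "y < 1"
  shows "card (exponents p r d) \<le> (1 / y) ^ d * (1 / (1 - y)) ^ r"
proof -
  have "card (exponents p r d) * y ^ d = (\<Sum>e\<in>exponents p r d. y ^ d)" by simp
  also have "\<dots> \<le> (\<Sum>e\<in>exponents p r d. y ^ sum_list e)"
    using y by (intro sum_mono power_decreasing) (auto simp: exponents_def)
  also have "\<dots> \<le> (\<Sum>e\<in>Fpn p r. y ^ sum_list e)"
    using y by (intro sum_mono2) (auto simp: exponents_def)
  also have "\<dots> = (\<Sum>e\<in>Fpn p r. \<Prod>i<r. y ^ (e ! i))"
    by (intro sum.cong refl) (auto simp: Fpn_def sum_list_sum_nth power_sum atLeast0LessThan)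
  also have "\<dots> = (\<Sum>j<p. y ^ j) ^ r"
    using prod_sum_nlists[where F = "\<lambda>i j. y ^ j" and A = "{..<p}" and n = r]
    by (simp add: Fpn_eq_nlists)
  also have "\<dots> \<le> (1 / (1 - y)) ^ r"
  proof (intro power_mono)
    have "(\<Sum>j<p. y ^ j) = (1 - y ^ p) / (1 - y)" using y by (simp add: sum_gp_strict)
    also have "\<dots> \<le> 1 / (1 - y)" using y by (intro divide_right_mono) auto
    finally show "(\<Sum>j<p. y ^ j) \<le> 1 / (1 - y)" .
  qed (use y in \<open>auto intro: sum_nonneg\<close>)
  finally show ?thesis using y by (simp add: field_simps power_divide)
qed

lemma card_exponents_le_poly:
  assumes "r > 0" shows "card (exponents p r d) \<le> 3 * (real r + 1) ^ d"
proof -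
  let ?y = "1 / (real r + 1)"
  have "1 / (1 - ?y) = 1 + 1 / real r" using assms by (simp add: field_simps)
  then have "card (exponents p r d) \<le> (1 / ?y) ^ d * (1 + 1 / real r) ^ r"
    using card_exponents_le[of ?y r d] assms by simp
  also have "(1 + 1 / real r) ^ r \<le> exp (1 / real r) ^ r"
    using exp_ge_add_one_self[of "1 / real r"] by (intro power_mono) auto
  also have "\<dots> = exp 1" using assms by (simp add: exp_of_nat_mult[symmetric])
  also have "\<dots> \<le> 3" by (rule exp_le)
  finally show ?thesis by (simp add: mult.commute)
qed

lemma block_size_le: "block_size r d \<le> 2 ^ d * (card (exponents p r d) * ln p + 1) + 2"
proof -
  have "0 \<le> 2 ^ d * (card (exponents p r d) * ln p + 1)" using ln_p_nonneg by simp
  then show ?thesis unfolding block_size_def samples_def by linarith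
qed

definition size_factor :: "nat \<Rightarrow> real" where
  "size_factor d = 2 ^ d * (3 * ln p + 1) + 2"

lemma size_factor_pos: "0 < size_factor d"
  unfolding size_factor_def using ln_p_nonneg by (intro add_nonneg_pos mult_nonneg_nonneg) auto

lemma block_size_le_poly:
  assumes "r > 0"
  shows "block_size r d \<le> size_factor d * (real r + 1) ^ d"
proof -
  let ?R = "(real r + 1) ^ d"
  have R1: "1 \<le> ?R" by simp
  have "block_size r d \<le> 2 ^ d * (card (exponents p r d) * ln p + 1) + 2" by (rule block_size_le)
  also have "\<dots> \<le> 2 ^ d * (3 * ?R * ln p + ?R) + 2 * ?R"
    using card_exponents_le_poly[OF assms, of d] ln_p_nonneg R1
    by (intro add_mono mult_left_mono mult_right_mono) auto
  finally show ?thesis by (simp add: size_factor_def algebra_simps)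
qed

lemma one_le_900_pow_block_rejection:
  assumes "d > 0" shows "1 \<le> 900 ^ d * block_rejection d"
proof -
  let ?D = "(2::real) ^ (Suc d + (d + 2) + (d + 2))"
  have "?D \<le> 2 ^ (8 * d)" using assms by (intro power_increasing) auto
  also have "\<dots> = 256 ^ d" by (simp add: power_mult)
  also have "\<dots> \<le> 900 ^ d" by (intro power_mono) auto
  finally have D_le: "?D \<le> 900 ^ d" .
  have "real (Suc d) < 2 ^ Suc d" by (rule of_nat_less_two_power)
  then have "2 ^ Suc d * (real (Suc d) + 2 ^ Suc d) \<le> 2 ^ Suc d * (2 ^ Suc d + 2 ^ Suc d)"
    by (intro mult_left_mono add_right_mono) auto
  then have "1 / (2 ^ Suc d * (2 ^ Suc d + 2 ^ Suc d)) \<le> robustness (Suc d)"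
    unfolding robustness_def using robustness_denom_pos by (intro divide_left_mono) auto
  then have "1 / (2 ^ Suc d * (2 ^ Suc d + 2 ^ Suc d)) / 2 ^ (d + 2) \<le> block_rejection d"
    unfolding block_rejection_def by (intro divide_right_mono) auto
  moreover have "?D = 2 ^ Suc d * (2 ^ Suc d + 2 ^ Suc d) * 2 ^ (d + 2)"
    unfolding power_add by simp
  ultimately have "1 / ?D \<le> block_rejection d" by simp
  with D_le have "?D * (1 / ?D) \<le> 900 ^ d * block_rejection d" by (intro mult_mono) auto
  then show ?thesis by simp
qed

lemma card_exponents_le_power_3:
  fixes W :: real
  assumes W: "W ^ 20 = real p ^ n" "30 ^ d \<le> W" and r: "r \<le> n + d"
  shows "card (exponents p r d) \<le> W ^ 3"
proof -
  have "(256 / 15 :: real) ^ d \<le> 30 ^ d" by (intro power_mono) auto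
  then have le_W: "(256 / 15) ^ d \<le> W" using W(2) by simp
  moreover have "0 \<le> (256 / 15 :: real) ^ d" by simp
  ultimately have "0 \<le> W" by (rule order_trans[rotated])
  have "(16 / 15) ^ n \<le> W ^ 2"
  proof (rule power_le_imp_le_base[where n = 9])
    have "((16 / 15 :: real) ^ n) ^ Suc 9 = ((16 / 15) ^ 10) ^ n"
      by (simp add: power_mult[symmetric] mult.commute)
    also have "\<dots> \<le> real p ^ n"
      using p_ge_2 by (intro power_mono) (auto simp: power_divide)
    also have "\<dots> = (W ^ 2) ^ Suc 9" by (simp add: W(1)[symmetric] power_mult[symmetric])
    finally show "((16 / 15 :: real) ^ n) ^ Suc 9 \<le> (W ^ 2) ^ Suc 9" .
  qed simp
  have "card (exponents p r d) \<le> 16 ^ d * (16 / 15) ^ r"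
    using card_exponents_le[of "1 / 16" r d] by simp
  also have "\<dots> \<le> 16 ^ d * (16 / 15) ^ (n + d)"
    using r by (intro mult_left_mono power_increasing) auto
  also have "\<dots> = (256 / 15) ^ d * (16 / 15) ^ n"
    by (simp add: power_add power_mult_distrib[symmetric])
  also have "\<dots> \<le> W * W ^ 2"
    using le_W \<open>(16 / 15) ^ n \<le> W ^ 2\<close> \<open>0 \<le> W\<close> by (intro mult_mono) auto
  finally show ?thesis by (simp add: power3_eq_cube power2_eq_square mult.assoc)
qed

lemma ln_p_le_square:
  fixes W :: real
  assumes "n > 0" and W: "W ^ 20 = real p ^ n" "30 \<le> W"
  shows "ln p \<le> W ^ 2"
proof -
  have "ln p \<le> n * ln p" using \<open>n > 0\<close> ln_p_nonneg by (cases n) (auto simp: algebra_simps)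
  also have "\<dots> = ln (W ^ 20)" unfolding W(1) using p_pos by (simp add: ln_realpow)
  also have "\<dots> = 20 * ln W" using W(2) by (simp add: ln_realpow)
  also have "\<dots> \<le> 20 * W" using ln_le_minus_one[of W] W(2) by simp
  also have "\<dots> \<le> W ^ 2" using W(2) by (simp add: power2_eq_square)
  finally show ?thesis .
qed

lemma block_size_le_power_7:
  fixes W :: real
  assumes "n > 0" "d > 0" and W: "W ^ 20 = real p ^ n" "30 ^ d \<le> W" and r: "r \<le> n + d"
  shows "block_size r d \<le> W ^ 7"
proof -
  have "(30::real) ^ 1 \<le> 30 ^ d" using \<open>d > 0\<close> by (intro power_increasing) auto
  then have W_ge_30: "30 \<le> W" using W(2) by simp
  have "(2::real) ^ d \<le> 30 ^ d" by (intro power_mono) auto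
  then have two_pow_le: "2 ^ d \<le> W" using W(2) by simp
  have "block_size r d \<le> 2 ^ d * (card (exponents p r d) * ln p + 1) + 2" by (rule block_size_le)
  also have "\<dots> \<le> W * (W ^ 3 * W ^ 2 + 1) + 2"
    using card_exponents_le_power_3[OF W r] ln_p_le_square[OF \<open>n > 0\<close> W(1) W_ge_30]
      two_pow_le ln_p_nonneg W_ge_30
    by (intro add_mono mult_mono) auto
  also have "\<dots> = W ^ 6 + (W + 2)" by (simp add: algebra_simps flip: power_add power_Suc)
  also have "\<dots> \<le> W ^ 6 + 2 * W ^ 6"
    using power_increasing[of 1 6 W] W_ge_30 by simp
  also have "\<dots> \<le> W * W ^ 6" using W_ge_30 by simp
  finally show ?thesis by (simp flip: power_Suc)
qed

abbreviation admissible :: "nat \<Rightarrow> nat \<Rightarrow> real \<Rightarrow> nat \<Rightarrow> bool" where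
  "admissible n d \<delta> t \<equiv> n > 0 \<and> 0 < \<delta> \<and> \<delta> \<le> 1 \<and>
     real t \<le> \<delta> / 30 * real p powr (real n / (20 * real d))"

lemma ex_twentieth_root:
  assumes d: "d > 0" and adm: "admissible n d \<delta> t" and t: "t > 0"
  shows "\<exists>W::real. W ^ 20 = real p ^ n \<and> 30 ^ d \<le> W \<and> 30 * real t \<le> \<delta> * W"
proof -
  define L where "L = real p powr (real n / (20 * real d))"
  have \<delta>: "0 \<le> \<delta>" "\<delta> \<le> 1" and "real t \<le> \<delta> / 30 * L" using adm unfolding L_def by auto
  then have t_le: "30 * real t \<le> \<delta> * L" by simp
  also have "\<dots> \<le> L" by (rule mult_left_le_one_le) (simp_all add: \<delta> L_def)
  finally have "30 * real t \<le> L" .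
  moreover have "1 \<le> real t" using t by simp
  ultimately have L_ge_30: "30 \<le> L" by linarith
  have "(L ^ d) ^ 20 = L ^ (d * 20)" by (simp add: power_mult)
  also have "\<dots> = L powr (real (d * 20))" using L_ge_30 by (subst powr_realpow) auto
  also have "\<dots> = real p powr real n" unfolding L_def powr_powr using d by simp
  also have "\<dots> = real p ^ n" by (simp add: powr_realpow)
  finally have "(L ^ d) ^ 20 = real p ^ n" .
  moreover have "30 ^ d \<le> L ^ d" using L_ge_30 by (intro power_mono) auto
  moreover have "30 * real t \<le> \<delta> * L ^ d"
  proof -
    have "L \<le> L ^ d" using power_increasing[of 1 d L] L_ge_30 d by simp
    then have "\<delta> * L \<le> \<delta> * L ^ d" using \<delta>(1) by (rule mult_left_mono)
    with t_le show ?thesis by (rule order_trans)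
  qed
  ultimately show ?thesis by blast
qed

lemma rank_suffices_small:
  assumes d: "d > 0" and adm: "admissible n d \<delta> t"
  shows "rank_suffices n d \<delta> t (max n (Suc d))"
proof (cases "t = 0")
  case True
  then show ?thesis by (simp add: rank_suffices_def)
next
  case False
  then obtain W :: real where W: "W ^ 20 = real p ^ n" "30 ^ d \<le> W" "30 * real t \<le> \<delta> * W"
    using ex_twentieth_root[OF d adm] by blast
  let ?s = "real (block_size (max n (Suc d)) d)"
  have size_le: "?s \<le> W ^ 7"
    using adm d W(1,2) by (intro block_size_le_power_7) auto
  have rejection_ge: "1 \<le> W ^ 2 * block_rejection d"
  proof -
    have "900 ^ d = ((30::real) ^ d) ^ 2" by (simp add: power2_eq_square flip: power_mult_distrib)
    also have "\<dots> \<le> W ^ 2" using W(2) by (intro power_mono) auto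
    finally have "900 ^ d * block_rejection d \<le> W ^ 2 * block_rejection d"
      using block_rejection_pos[of d] by (intro mult_right_mono) auto
    then show ?thesis using one_le_900_pow_block_rejection[OF d] by simp
  qed
  have t_le: "20 * real t \<le> (\<delta> * W) ^ 2"
  proof -
    have "real t * 1 \<le> (\<delta> * W / 30) * (\<delta> * W / 30)"
      using W(3) False by (intro mult_mono) auto
    then show ?thesis by (simp add: power2_eq_square)
  qed
  have "20 * ?s ^ 2 * t = ?s ^ 2 * (20 * t)" by simp
  also have "\<dots> \<le> (W ^ 7) ^ 2 * (\<delta> * W) ^ 2"
    using size_le t_le by (intro mult_mono power_mono) auto
  also have "\<dots> \<le> (W ^ 7) ^ 2 * (\<delta> * W) ^ 2 * (W ^ 2 * block_rejection d) ^ 2"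
    using mult_left_mono[OF one_le_power[OF rejection_ge, of 2], of "(W ^ 7) ^ 2 * (\<delta> * W) ^ 2"]
    by simp
  also have "\<dots> = (block_rejection d * \<delta>) ^ 2 * W ^ 20"
    by (simp add: power_mult_distrib mult_ac flip: power_mult power_add)
  finally show ?thesis
    by (simp add: rank_suffices_def W(1))
qed

lemma rank_suffices_large:
  assumes \<delta>: "0 < \<delta>" "\<delta> \<le> 1" and r: "Suc d \<le> r" "r \<le> n"
    and growth: "20 * size_factor d ^ 2 * (real r + 1) ^ (2 * d)
      \<le> block_rejection d ^ 2 * real p powr (real r / 2)"
    and log_le: "4 * log p (t / \<delta>) \<le> r"
  shows "rank_suffices n d \<delta> t r"
proof (cases "t = 0")
  case True
  then show ?thesis using r by (simp add: rank_suffices_def)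
next
  case False
  have "t \<le> real t ^ 2" using False by (simp add: self_le_power)
  also have "\<dots> = \<delta> ^ 2 * (p powr log p (t / \<delta>)) ^ 2"
    using False \<delta> p_ge_2 by (simp add: power_divide)
  also have "\<dots> = \<delta> ^ 2 * p powr (2 * log p (t / \<delta>))" by (simp add: powr_power mult.commute)
  also have "\<dots> \<le> \<delta> ^ 2 * p powr (real r / 2)"
    using log_le p_ge_2 by (intro mult_left_mono powr_mono) auto
  finally have t_le: "t \<le> \<delta> ^ 2 * p powr (real r / 2)" .
  have "20 * real (block_size r d) ^ 2 * t \<le> 20 * (size_factor d * (real r + 1) ^ d) ^ 2 * t"
    using block_size_le_poly[of r d] r by (intro mult_right_mono mult_left_mono power_mono) auto
  also have "20 * (size_factor d * (real r + 1) ^ d) ^ 2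
      = 20 * size_factor d ^ 2 * (real r + 1) ^ (2 * d)"
    by (simp add: power_mult_distrib mult.commute flip: power_mult)
  also have "\<dots> * t \<le> block_rejection d ^ 2 * p powr (real r / 2) * (\<delta> ^ 2 * p powr (real r / 2))"
    by (rule mult_mono[OF growth t_le]) auto
  also have "\<dots> = (block_rejection d * \<delta>) ^ 2 * p ^ r"
    by (simp add: power_mult_distrib powr_realpow mult_ac flip: powr_add)
  finally show ?thesis using r by (simp add: rank_suffices_def)
qed

lemma log_erasure_ratio_le:
  assumes d: "d > 0" and adm: "admissible n d \<delta> t"
  shows "4 * log p (t / \<delta>) \<le> n"
proof (cases "t = 0")
  case False
  have "t / \<delta> \<le> real p powr (real n / (20 * real d)) / 30" using adm by (simp add: field_simps)
  also have "\<dots> \<le> real p powr (real n / (20 * real d))" by simp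
  finally have "log p (t / \<delta>) \<le> log p (real p powr (real n / (20 * real d)))"
    using False adm p_ge_2 by (subst log_le_cancel_iff) auto
  also have "\<dots> = real n / (20 * real d)" using p_ge_2 by simp
  also have "\<dots> \<le> real n / 4" using d by (intro divide_left_mono) auto
  finally show ?thesis by simp
qed (simp add: log_def)

lemma log_le_2_ln:
  assumes "0 \<le> x" shows "log p x \<le> 2 * ln (1 + x)"
proof (cases "x = 0")
  case False
  have "exp (1 / 2) ^ 2 \<le> (2::real) ^ 2"
    using exp_le by (simp add: power2_eq_square flip: exp_add)
  then have "exp (1 / 2) \<le> (2::real)" by (rule power2_le_imp_le) simp
  also have "\<dots> \<le> p" using p_ge_2 by simp
  finally have lnp: "1 / 2 \<le> ln p" by (subst ln_ge_iff) simp_all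
  have "ln x \<le> ln (1 + x)" using False assms by simp
  then have "log p x \<le> ln (1 + x) / ln p"
    unfolding log_def by (rule divide_right_mono) (rule ln_p_nonneg)
  also have "\<dots> \<le> ln (1 + x) / (1 / 2)"
    using lnp assms p_ge_2 by (intro divide_left_mono) auto
  finally show ?thesis by simp
qed (simp add: log_def)

lemma ex_growth_threshold:
  "\<exists>r0. \<forall>r\<ge>r0. 20 * size_factor d ^ 2 * (real r + 1) ^ (2 * d)
    \<le> block_rejection d ^ 2 * real p powr (real r / 2)"
proof -
  have "0 < size_factor d" "0 < block_rejection d" "1 < real p"
    using size_factor_pos block_rejection_pos p_ge_2 by auto
  then have "eventually (\<lambda>r::nat. 20 * size_factor d ^ 2 * (real r + 1) ^ (2 * d)
      \<le> block_rejection d ^ 2 * real p powr (real r / 2)) sequentially"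
    by real_asymp
  then show ?thesis unfolding eventually_sequentially .
qed

lemma ex_rank_above_threshold:
  assumes d: "d > 0" and adm: "admissible n d \<delta> t" and "Suc d \<le> r0"
    and growth: "\<forall>r\<ge>r0. 20 * size_factor d ^ 2 * (real r + 1) ^ (2 * d)
      \<le> block_rejection d ^ 2 * real p powr (real r / 2)"
  shows "\<exists>r. rank_suffices n d \<delta> t r \<and> real r \<le> r0 + 8 * ln (1 + t / \<delta>) + 1"
proof (cases "n < r0")
  case True
  then have "real (max n (Suc d)) \<le> r0 + 8 * ln (1 + t / \<delta>) + 1"
    using adm \<open>Suc d \<le> r0\<close> by (simp add: add_increasing2)
  with rank_suffices_small[OF d adm] show ?thesis by blast
next
  case False
  define r where "r = max r0 (nat \<lceil>4 * log p (t / \<delta>)\<rceil>)"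
  have "r \<le> n" using False log_erasure_ratio_le[OF d adm]
    unfolding r_def by (simp add: nat_le_iff ceiling_le_iff)
  moreover have "4 * log p (t / \<delta>) \<le> r" unfolding r_def by linarith
  moreover have "r0 \<le> r" by (simp add: r_def)
  ultimately have "rank_suffices n d \<delta> t r"
    using adm growth \<open>Suc d \<le> r0\<close> by (intro rank_suffices_large) auto
  moreover have "0 \<le> t / \<delta>" using adm by simp
  then have "log p (t / \<delta>) \<le> 2 * ln (1 + t / \<delta>)" "0 \<le> ln (1 + t / \<delta>)"
    by (simp_all add: log_le_2_ln)
  then have "real r \<le> r0 + 8 * ln (1 + t / \<delta>) + 1" unfolding r_def by linarith
  ultimately show ?thesis by blast
qed

lemma ex_sufficient_rank:
  assumes d: "d > 0"
  shows "\<exists>c>0. \<forall>n \<delta> t. admissible n d \<delta> t \<longrightarrow>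
     (\<exists>r. rank_suffices n d \<delta> t r \<and> real r + 1 \<le> c * (1 + ln (1 + t / \<delta>)))"
proof -
  obtain r0 where growth: "\<forall>r\<ge>r0. 20 * size_factor d ^ 2 * (real r + 1) ^ (2 * d)
      \<le> block_rejection d ^ 2 * real p powr (real r / 2)"
    using ex_growth_threshold by blast
  define r1 where "r1 = max r0 (Suc d)"
  have "\<exists>r. rank_suffices n d \<delta> t r \<and> real r + 1 \<le> (real r1 + 10) * (1 + ln (1 + t / \<delta>))"
    if adm: "admissible n d \<delta> t" for n \<delta> t
  proof -
    obtain r where r: "rank_suffices n d \<delta> t r" "real r \<le> r1 + 8 * ln (1 + t / \<delta>) + 1"
      using ex_rank_above_threshold[OF d adm, of r1] growth by (auto simp: r1_def)
    have "0 \<le> ln (1 + t / \<delta>)" using adm by simp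
    then have "0 \<le> real r1 * ln (1 + t / \<delta>)" by simp
    with \<open>0 \<le> ln (1 + t / \<delta>)\<close> r(2) have "real r + 1 \<le> (real r1 + 10) * (1 + ln (1 + t / \<delta>))"
      unfolding distrib_left distrib_right by linarith
    with r(1) show ?thesis by blast
  qed
  moreover have "0 < real r1 + 10" by simp
  ultimately show ?thesis by blast
qed

lemma block_size_le_polylog:
  assumes "Suc d \<le> r" and r: "real r + 1 \<le> c * \<Lambda>" and \<Lambda>: "1 \<le> \<Lambda>" and c: "0 \<le> c"
  shows "block_size r d \<le> size_factor d * c ^ d * \<Lambda> ^ (3 * d + 3)"
proof -
  have "block_size r d \<le> size_factor d * (real r + 1) ^ d"
    using assms(1) by (intro block_size_le_poly) simp
  also have "\<dots> \<le> size_factor d * (c * \<Lambda>) ^ d"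
    using r size_factor_pos[of d] by (intro mult_left_mono power_mono) auto
  also have "\<dots> = size_factor d * c ^ d * \<Lambda> ^ d"
    by (simp add: power_mult_distrib)
  also have "\<dots> \<le> size_factor d * c ^ d * \<Lambda> ^ (3 * d + 3)"
    using \<Lambda> c size_factor_pos[of d] by (intro mult_left_mono power_increasing) auto
  finally show ?thesis .
qed

definition query_factor :: "nat \<Rightarrow> real \<Rightarrow> real" where
  "query_factor d c = 5 / block_rejection d * (size_factor d * c ^ d)"

lemma query_factor_pos: "c > 0 \<Longrightarrow> query_factor d c > 0"
  unfolding query_factor_def using block_rejection_pos[of d] size_factor_pos[of d] by simp

lemma affine_tester_polylog:
  assumes \<delta>: "0 < \<delta>" "\<delta> \<le> 1" and rank: "rank_suffices n d \<delta> t r"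
    and r: "real r + 1 \<le> c * (1 + ln (1 + t / \<delta>))" and c: "c > 0"
  shows "\<exists>T q. real q \<le> query_factor d c * (1 + ln (1 + t / \<delta>)) ^ (3 * d + 3) / \<delta> \<and>
    valid_tester p n d \<delta> t T q"
proof -
  let ?\<Lambda> = "1 + ln (1 + t / \<delta>)"
  obtain T q where q: "real q \<le> 5 * block_size r d / (block_rejection d * \<delta>)"
    "valid_tester p n d \<delta> t T q"
    using affine_tester[OF \<delta> rank] by blast
  have "block_size r d \<le> size_factor d * c ^ d * ?\<Lambda> ^ (3 * d + 3)"
    using rank r \<delta> c by (intro block_size_le_polylog) (simp_all add: rank_suffices_def)
  then have "5 * block_size r d / (block_rejection d * \<delta>)
      \<le> 5 * (size_factor d * c ^ d * ?\<Lambda> ^ (3 * d + 3)) / (block_rejection d * \<delta>)"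
    using block_rejection_pos[of d] \<delta> by (simp add: divide_right_mono)
  also have "\<dots> = query_factor d c * ?\<Lambda> ^ (3 * d + 3) / \<delta>"
    by (simp add: query_factor_def)
  finally show ?thesis using q order_trans by blast
qed

end

theorem theorem1p1:
  fixes p d :: nat
  assumes "prime p" and "d > 0"
  shows "\<exists>C::real. C > 0 \<and>
    (\<forall>(n::nat) (\<delta>::real) (t::nat).
       n > 0 \<and> 0 < \<delta> \<and> \<delta> \<le> 1 \<and>
       real t \<le> \<delta> / 30 * real p powr (real n / (20 * real d)) \<longrightarrow>
       (\<exists>(T :: hist \<Rightarrow> action pmf) (q::nat).
          real q \<le> C * (1 + ln (1 + real t / \<delta>)) ^ (3 * d + 3) / \<delta> \<and>
          query_bounded T q \<and>
          (\<forall>f A. is_fn p n f \<and> deg_le p n d f \<and> valid_adversary t A \<longrightarrow>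
                 accept_prob T q A f = 1) \<and>
          (\<forall>f A. is_fn p n f \<and> far_from_deg p n d \<delta> f \<and> valid_adversary t A \<longrightarrow>
                 reject_prob T q A f \<ge> 2/3)))"
proof -
  interpret prime_modulus p by unfold_locales (rule assms(1))
  obtain c where "c > 0" and rank: "\<And>n \<delta> t. admissible n d \<delta> t \<Longrightarrow>
      \<exists>r. rank_suffices n d \<delta> t r \<and> real r + 1 \<le> c * (1 + ln (1 + t / \<delta>))"
    using ex_sufficient_rank[OF assms(2)] by blast
  have "\<exists>T q. real q \<le> query_factor d c * (1 + ln (1 + t / \<delta>)) ^ (3 * d + 3) / \<delta> \<and>
      valid_tester p n d \<delta> t T q" if adm: "admissible n d \<delta> t" for n \<delta> t
  proof -
    obtain r where "rank_suffices n d \<delta> t r" "real r + 1 \<le> c * (1 + ln (1 + t / \<delta>))"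
      using rank[OF adm] by blast
    then show ?thesis using adm \<open>c > 0\<close> by (intro affine_tester_polylog) auto
  qed
  then show ?thesis
    using query_factor_pos[OF \<open>c > 0\<close>] unfolding valid_tester_def
    by (intro exI[of _ "query_factor d c"] conjI allI impI)
qed

end
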